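(* Let $\Lambda\in(\mathbb R_+^\ast)^N$ and let $\mathcal A\subset L^\infty_{\mathrm{loc}}(\mathbb R,\mathcal M_d(\mathbb C)^N)$ be uniformly locally bounded. For every $L\in V_+(\Lambda)$, if $\Sigma_\delta(L,\mathcal A)$ is of $(\Theta,\Lambda)$-exponential type $\gamma$ then, for every $p\in[1,+\infty]$, it is of exponential type $\gamma$ in $\mathsf X_p^\delta$. Conversely, for every $L\in W_+(\Lambda)$, if there exists $p\in[1,+\infty]$ such that $\Sigma_\delta(L,\mathcal A)$ is of exponential type $\gamma$ in $\mathsf X_p^\delta$, then it is of $(\Theta,\Lambda)$-exponential type $\gamma$. Finally, for every $L\in W_+(\Lambda)$ and $p\in[1,+\infty]$, $$\lambda_p(L,\mathcal A)=\limsup_{L\cdot\mathbf n\to+\infty}\ \sup_{A\in\mathcal A}\ \operatorname*{ess\,sup}_{t\in(L\cdot\mathbf n-L_{\max},\,L\cdot\mathbf n)}\frac{\ln\big|\Theta^{L,\Lambda,A}_{[\mathbf n],t}\big|}{t},$$ where the limsup is over $\mathbf n\in\mathbb N^N$.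
   Context: $\mathbb N=\{0,1,2,\dots\}$, $\mathbb R_+^\ast=(0,+\infty)$; $\mathcal M_d(\mathbb C)$ is the set of complex $d\times d$ matrices, with a fixed norm $|\cdot|$; $e_1,\dots,e_N$ is the canonical basis of $\mathbb Z^N$; $L_{\max}$ is the largest component of $L$. Convention $\ln0=-\infty$. $\mathcal A$ is uniformly locally bounded if $\sup_{A\in\mathcal A}\|A\|_{L^\infty(I,\mathcal M_d(\mathbb C)^N)}<\infty$ for every compact interval $I$. For $L\in(\mathbb R_+^\ast)^N$ and $A=(A_1,\dots,A_N)$, $\Sigma_\delta(L,A)$ is the difference equation $u(t)=\sum_{j=1}^NA_j(t)u(t-L_j)$ for $t\ge0$, $u(t)\in\mathbb C^d$, with initial condition $u=u_0$ on $[-L_{\max},0)$ (solutions are unique, as functions defined a.e.). $\mathsf X_p^\delta=L^p([-L_{\max},0],\mathbb C^d)$ with its usual norm $\|\cdot\|_p$; $u_t=u(\cdot+t)|_{[-L_{\max},0)}$. $\Sigma_\delta(L,\mathcal A)$ is the family of systems $\Sigma_\delta(L,A)$, $A\in\mathcal A$. $Z(\Lambda)=\{\mathbf n\in\mathbb Z^N:\Lambda\cdot\mathbf n=0\}$; $V_+(\Lambda)=\{L\in(\mathbb R_+^\ast)^N:Z(\Lambda)\subset Z(L)\}$; $W_+(\Lambda)=\{L\in(\mathbb R_+^\ast)^N:Z(\Lambda)=Z(L)\}$. $\Xi^{L,A}_{\mathbf n,t}$ ($\mathbf n\in\mathbb Z^N$, $t\in\mathbb R$): $\Xi^{L,A}_{\mathbf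 n,t}=0$ if $\mathbf n\notin\mathbb N^N$, $\Xi^{L,A}_{0,t}=\mathrm{Id}_d$, $\Xi^{L,A}_{\mathbf n,t}=\sum_{k=1}^NA_k(t)\Xi^{L,A}_{\mathbf n-e_k,t-L_k}$ if $\mathbf n\in\mathbb N^N\setminus\{0\}$. Let $i\sim j$ iff $\Lambda_i=\Lambda_j$, $\mathbf n\approx\mathbf n'$ iff $\Lambda\cdot\mathbf n=\Lambda\cdot\mathbf n'$, $[\cdot]$ the classes, $\mathcal J=\{1,\dots,N\}/\sim$. For $L\in V_+(\Lambda)$, $\widehat\Xi^{L,\Lambda,A}_{[\mathbf n],t}=\sum_{\mathbf n'\in[\mathbf n]}\Xi^{L,A}_{\mathbf n',t}$, $\widehat A^\Lambda_{[i]}(t)=\sum_{j\in[i]}A_j(t)$, and $\Theta^{L,\Lambda,A}_{[\mathbf n],t}=\sum_{[j]\in\mathcal J,\ L\cdot\mathbf n-L_j\le t}\widehat\Xi^{L,\Lambda,A}_{[\mathbf n-e_j],t}\widehat A^\Lambda_{[j]}(t-L\cdot\mathbf n+L_j)$. Exponential types ($\gamma\in\mathbb R$). $\Sigma_\delta(L,\mathcal A)$ is of exponential type $\gamma$ in $\mathsf X_p^\delta$ if for every $\varepsilon>0$ there is $K>0$ such that for all $A\in\mathcal A$, $u_0\in\mathsf X_p^\delta$, $t\ge0$, the solution satisfies $\|u_t\|_p\le Ke^{(\gamma+\varepsilon)t}\|u_0\|_p$. It is of $(\Theta,\Lambda)$-exponential type $\gamma$ if for every $\varepsilon>0$ there is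 $K>0$ such that for all $A\in\mathcal A$, $\mathbf n\in\mathbb N^N$ and a.e. $t\in(L\cdot\mathbf n-L_{\max},L\cdot\mathbf n)$, $|\Theta^{L,\Lambda,A}_{[\mathbf n],t}|\le Ke^{(\gamma+\varepsilon)t}$. The maximal Lyapunov exponent is $\lambda_p(L,\mathcal A)=\limsup_{t\to+\infty}\sup_{A\in\mathcal A}\sup_{u_0\in\mathsf X_p^\delta,\|u_0\|_p=1}\frac{\ln\|u_t\|_p}{t}$. *)

theory Defs
  imports "HOL-Analysis.Analysis" "HOL-Probability.Essential_Supremum"
    "HOL-Library.Going_To_Filter"
begin

text \<open>Matrices carry an arbitrary norm \<open>\<nu>\<close> of the complex vector space of square matrices;
  it need not be submultiplicative.\<close>

definition matrix_norm :: "(complex^'d^'d \<Rightarrow> real) \<Rightarrow> bool" where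
  "matrix_norm \<nu> \<longleftrightarrow>
     (\<forall>M. 0 \<le> \<nu> M) \<and>
     (\<forall>M. \<nu> M = 0 \<longleftrightarrow> M = 0) \<and>
     (\<forall>c M. \<nu> (\<chi> i j. c * M $ i $ j) = cmod c * \<nu> M) \<and>
     (\<forall>M P. \<nu> (M + P) \<le> \<nu> M + \<nu> P)"

definition ennroot :: "real \<Rightarrow> ennreal \<Rightarrow> ennreal" where
  "ennroot q x = (if x = \<infinity> then \<infinity> else ennreal (enn2real x powr (1 / q)))"

definition Lp_norm :: "ennreal \<Rightarrow> real set \<Rightarrow> (real \<Rightarrow> 'a::real_normed_vector) \<Rightarrow> ennreal" where
  "Lp_norm p I f =
     (if p = \<infinity> then esssup (lebesgue_on I) (\<lambda>s. ennreal (norm (f s)))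
      else ennroot (enn2real p)
             (\<integral>\<^sup>+ s. ennreal (norm (f s) powr enn2real p) \<partial>lebesgue_on I))"

definition eln :: "ennreal \<Rightarrow> ereal" where
  "eln x = (if x = 0 then -\<infinity> else if x = \<infinity> then \<infinity> else ereal (ln (enn2real x)))"

definition Linf_norm :: "(complex^'d^'d \<Rightarrow> real) \<Rightarrow> real set
    \<Rightarrow> (real \<Rightarrow> complex^'d^'d^'n) \<Rightarrow> ennreal" where
  "Linf_norm \<nu> I A = esssup (lebesgue_on I) (\<lambda>t. ennreal (MAX j. \<nu> (A t $ j)))"

definition Linf_loc :: "(complex^'d^'d \<Rightarrow> real) \<Rightarrow> (real \<Rightarrow> complex^'d^'d^'n) set" where
  "Linf_loc \<nu> = {A \<in> borel_measurable lebesgue. \<forall>a b. Linf_norm \<nu> {a..b} A < \<infinity>}"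

definition uniformly_locally_bounded ::
    "(complex^'d^'d \<Rightarrow> real) \<Rightarrow> (real \<Rightarrow> complex^'d^'d^'n) set \<Rightarrow> bool" where
  "uniformly_locally_bounded \<nu> \<A> \<longleftrightarrow> (\<forall>a b. (SUP A\<in>\<A>. Linf_norm \<nu> {a..b} A) < \<infinity>)"

definition Lmax :: "real^'n \<Rightarrow> real" where
  "Lmax L = (MAX j. L $ j)"

definition zdot :: "real^'n \<Rightarrow> int^'n \<Rightarrow> real" where
  "zdot L n = (\<Sum>i\<in>UNIV. L $ i * real_of_int (n $ i))"

definition Nvec :: "(int^'n) set" where
  "Nvec = {n. \<forall>i. 0 \<le> n $ i}"

definition pos_vec :: "(real^'n) set" where
  "pos_vec = {L. \<forall>i. 0 < L $ i}"

definition Zset :: "real^'n \<Rightarrow> (int^'n) set" where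
  "Zset \<Lambda> = {n. zdot \<Lambda> n = 0}"

definition Vplus :: "real^'n \<Rightarrow> (real^'n) set" where
  "Vplus \<Lambda> = {L \<in> pos_vec. Zset \<Lambda> \<subseteq> Zset L}"

definition Wplus :: "real^'n \<Rightarrow> (real^'n) set" where
  "Wplus \<Lambda> = {L \<in> pos_vec. Zset \<Lambda> = Zset L}"

definition Xp :: "real^'n \<Rightarrow> ennreal \<Rightarrow> (real \<Rightarrow> complex^'d) set" where
  "Xp L p = {v \<in> borel_measurable (lebesgue_on {- Lmax L..0}). Lp_norm p {- Lmax L..0} v < \<infinity>}"

text \<open>Functions are identified when they agree almost everywhere; the values of \<open>u\<close> to the left
  of \<open>- Lmax L\<close> play no role.\<close>

definition is_solution :: "real^'n \<Rightarrow> (real \<Rightarrow> complex^'d^'d^'n) \<Rightarrow> (real \<Rightarrow> complex^'d)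
    \<Rightarrow> (real \<Rightarrow> complex^'d) \<Rightarrow> bool" where
  "is_solution L A u\<^sub>0 u \<longleftrightarrow>
     (AE t in lebesgue. 0 \<le> t \<longrightarrow> u t = (\<Sum>j\<in>UNIV. (A t $ j) *v u (t - L $ j))) \<and>
     (AE t in lebesgue. t \<in> {- Lmax L..<0} \<longrightarrow> u t = u\<^sub>0 t)"

definition seg_norm :: "real^'n \<Rightarrow> ennreal \<Rightarrow> (real \<Rightarrow> complex^'d) \<Rightarrow> real \<Rightarrow> ennreal" where
  "seg_norm L p u t = Lp_norm p {- Lmax L..0} (\<lambda>s. u (s + t))"

definition exp_type :: "real^'n \<Rightarrow> (real \<Rightarrow> complex^'d^'d^'n) set \<Rightarrow> ennreal \<Rightarrow> real \<Rightarrow> bool" where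
  "exp_type L \<A> p \<gamma> \<longleftrightarrow>
     (\<forall>\<epsilon>>0. \<exists>K>0. \<forall>A\<in>\<A>. \<forall>u\<^sub>0\<in>Xp L p. \<forall>t\<ge>0. \<forall>u. is_solution L A u\<^sub>0 u \<longrightarrow>
        seg_norm L p u t \<le> ennreal (K * exp ((\<gamma> + \<epsilon>) * t)) * Lp_norm p {- Lmax L..0} u\<^sub>0)"

definition max_lyapunov :: "real^'n \<Rightarrow> (real \<Rightarrow> complex^'d^'d^'n) set \<Rightarrow> ennreal \<Rightarrow> ereal" where
  "max_lyapunov L \<A> p =
     Limsup at_top (\<lambda>t::real. SUP A\<in>\<A>.
       SUP (u\<^sub>0, u)\<in>{(u\<^sub>0, u). u\<^sub>0 \<in> Xp L p \<and> Lp_norm p {- Lmax L..0} u\<^sub>0 = 1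
                            \<and> is_solution L A u\<^sub>0 u}.
         eln (seg_norm L p u t) / ereal t)"

function Xi :: "real^'n \<Rightarrow> (real \<Rightarrow> complex^'d^'d^'n) \<Rightarrow> int^'n \<Rightarrow> real \<Rightarrow> complex^'d^'d" where
  "Xi L A n t =
     (if n \<notin> Nvec then 0
      else if n = 0 then mat 1
      else (\<Sum>k\<in>UNIV. (A t $ k) ** Xi L A (n - axis k 1) (t - L $ k)))"
  by pat_completeness auto
termination
proof (relation "Wellfounded.measure (\<lambda>(L, A, n, t). nat (\<Sum>i\<in>UNIV. n $ i))", goal_cases)
  case (2 L A n t k)
  have nn: "\<forall>i. 0 \<le> n $ i"
    using 2 by (simp add: Nvec_def)
  obtain i where "n $ i \<noteq> 0"
    using 2 by (auto simp: vec_eq_iff)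
  then have "0 < (\<Sum>i\<in>UNIV. n $ i)"
    using nn by (intro sum_pos2[of _ i]) (auto simp: order_less_le)
  moreover have "(\<Sum>i\<in>UNIV. (n - axis k 1) $ i) = (\<Sum>i\<in>UNIV. n $ i) - 1"
    by (simp add: sum_subtractf axis_def)
  ultimately show ?case
    by simp
qed simp

declare Xi.simps [simp del]

definition index_class :: "real^'n \<Rightarrow> 'n \<Rightarrow> 'n set" where
  "index_class \<Lambda> i = {j. \<Lambda> $ j = \<Lambda> $ i}"

definition zclass :: "real^'n \<Rightarrow> int^'n \<Rightarrow> (int^'n) set" where
  "zclass \<Lambda> n = {n'. zdot \<Lambda> n' = zdot \<Lambda> n}"

text \<open>A class is usually infinite, but \<open>Xi\<close> vanishes outside \<open>Nvec\<close>, and for positive \<open>\<Lambda>\<close> a class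
  contains only finitely many points of \<open>Nvec\<close>; hence the intersection in the index set.\<close>

definition Xi_hat :: "real^'n \<Rightarrow> (real \<Rightarrow> complex^'d^'d^'n) \<Rightarrow> (int^'n) set \<Rightarrow> real
    \<Rightarrow> complex^'d^'d" where
  "Xi_hat L A C t = (\<Sum>n'\<in>C \<inter> Nvec. Xi L A n' t)"

definition A_hat :: "(real \<Rightarrow> complex^'d^'d^'n) \<Rightarrow> 'n set \<Rightarrow> real \<Rightarrow> complex^'d^'d" where
  "A_hat A J t = (\<Sum>j\<in>J. A t $ j)"

text \<open>The sum ranges over the index classes \<open>J\<close>, each with a chosen representative \<open>rep J\<close>. For
  \<open>L \<in> Vplus \<Lambda>\<close> the summands do not depend on this choice, and the value depends on \<open>n\<close> only
  through \<open>zclass \<Lambda> n\<close>.\<close>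

definition Theta :: "real^'n \<Rightarrow> real^'n \<Rightarrow> (real \<Rightarrow> complex^'d^'d^'n) \<Rightarrow> int^'n \<Rightarrow> real
    \<Rightarrow> complex^'d^'d" where
  "Theta L \<Lambda> A n t =
     (let rep = (\<lambda>J. SOME j. j \<in> J) in
      \<Sum>J\<in>{J \<in> range (index_class \<Lambda>). zdot L n - L $ rep J \<le> t}.
        Xi_hat L A (zclass \<Lambda> (n - axis (rep J) 1)) t ** A_hat A J (t - zdot L n + L $ rep J))"

definition Theta_exp_type :: "(complex^'d^'d \<Rightarrow> real) \<Rightarrow> real^'n \<Rightarrow> real^'n
    \<Rightarrow> (real \<Rightarrow> complex^'d^'d^'n) set \<Rightarrow> real \<Rightarrow> bool" where
  "Theta_exp_type \<nu> L \<Lambda> \<A> \<gamma> \<longleftrightarrow>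
     (\<forall>\<epsilon>>0. \<exists>K>0. \<forall>A\<in>\<A>. \<forall>n\<in>Nvec. AE t in lebesgue.
        t \<in> {zdot L n - Lmax L<..<zdot L n} \<longrightarrow> \<nu> (Theta L \<Lambda> A n t) \<le> K * exp ((\<gamma> + \<epsilon>) * t))"

end

theory Submission
  imports Defs
begin

text \<open>Unrolling the equation expresses \<open>u t\<close> through the initial datum as a sum of
  \<open>Theta L \<Lambda> A n t *v u\<^sub>0 (t - zdot L n)\<close> over the finitely many classes of \<open>n\<close> with
  \<open>t < zdot L n \<le> t + Lmax L\<close>. Their number grows polynomially in \<open>t\<close>, so exponential bounds on the
  coefficients pass to all \<open>L\<^sup>p\<close> norms at the cost of an arbitrarily small increase of the exponent.

  If \<open>L \<in> Wplus \<Lambda>\<close>, distinct classes have distinct values \<open>zdot L n\<close>. Suppose a column of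
  \<open>Theta L \<Lambda> A n\<close> were too large on a set \<open>E\<close> of positive measure and small diameter. Taking the
  indicator of \<open>E\<close>, shifted by \<open>zdot L n\<close>, times a basis vector as initial datum isolates this
  coefficient on \<open>E\<close> and violates the bound on the solution, for every \<open>p\<close>.

  The bounds for small times, which hold uniformly by local boundedness, show that for real \<open>\<gamma>\<close> each of
  the two limits superior is at most \<open>\<gamma>\<close> iff the corresponding exponential type \<open>\<gamma>\<close> holds.\<close>

text \<open>A pair (\<open>n\<close>, \<open>j\<close>) of a lattice point and a last delay reads
  the initial datum at the landing point \<open>t - zdot L n - L $ j\<close>. For
  \<open>L \<in> Vplus \<Lambda>\<close> all pairs of one \<open>\<Lambda>\<close>-class land
  together, so their matrices merge into one coefficient. Different classes may still collide, and
  large coefficients could then cancel inside the solution. \<open>Wplus \<Lambda>\<close> rules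
  such collisions out, whence the stronger assumption in the converse.

  The obstacle in the converse is uniformity in \<open>n\<close>. For incommensurable delays the
  values \<open>zdot L n\<close> cluster as they grow, so the diameter of the test set must shrink
  with \<open>n\<close>, while the final constant must not see it. This works because the test set
  occurs once in the initial interval and once in the solution window, as translates of equal
  measure. The measure cancels from the comparison of norms for every \<open>p\<close>, and the
  diameter enters only through the requirement that it is at most \<open>Lmax L\<close>.

  All pointwise reasoning follows \<open>t\<close> backwards through the times
  \<open>t - zdot L n\<close>. The lattice is countable, so the exceptional sets met on the way stay
  null.\<close>

section \<open>Delays, lattice sums and counting\<close>

definition delay_min :: "real^'n \<Rightarrow> real" where
  "delay_min L = (MIN j. L $ j)"

lemma delay_min_le: "delay_min L \<le> L $ j"
  unfolding delay_min_def by (rule Min_le) auto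

lemma delay_min_pos: "L \<in> pos_vec \<Longrightarrow> 0 < delay_min L"
  unfolding delay_min_def pos_vec_def by (subst Min_gr_iff) auto

lemma le_Lmax: "L $ j \<le> Lmax L"
  unfolding Lmax_def by (rule Max_ge) auto

lemma Lmax_pos: "L \<in> pos_vec \<Longrightarrow> 0 < Lmax L"
  by (rule less_le_trans[OF _ le_Lmax[of L undefined]]) (simp add: pos_vec_def)

lemma zdot_add: "zdot L (m + n) = zdot L m + zdot L n"
  by (simp add: zdot_def algebra_simps sum.distrib)

lemma zdot_diff: "zdot L (m - n) = zdot L m - zdot L n"
  by (simp add: zdot_def algebra_simps sum_subtractf)

lemma zdot_axis [simp]: "zdot L (axis j 1) = L $ j"
proof -
  have "zdot L (axis j 1) = (\<Sum>i\<in>UNIV. if i = j then L $ i else 0)"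
    unfolding zdot_def by (rule sum.cong) (auto simp: axis_def)
  then show ?thesis by simp
qed

lemma zdot_zero [simp]: "zdot L 0 = 0"
  by (simp add: zdot_def)

lemma zdot_nonneg: "L \<in> pos_vec \<Longrightarrow> n \<in> Nvec \<Longrightarrow> 0 \<le> zdot L n"
  unfolding zdot_def pos_vec_def Nvec_def by (intro sum_nonneg mult_nonneg_nonneg) (auto intro: less_imp_le)

lemma zero_in_Nvec [simp]: "0 \<in> Nvec"
  by (simp add: Nvec_def)

lemma Nvec_add_axis [simp]: "n \<in> Nvec \<Longrightarrow> n + axis j 1 \<in> Nvec"
  by (auto simp: Nvec_def axis_def)

lemma zdot_ge_component:
  assumes "L \<in> pos_vec" "n \<in> Nvec"
  shows "delay_min L * real_of_int (n $ i) \<le> zdot L n"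
proof -
  have "delay_min L * real_of_int (n $ i) \<le> L $ i * real_of_int (n $ i)"
    using assms delay_min_le[of L i] by (intro mult_right_mono) (auto simp: Nvec_def)
  also have "\<dots> \<le> zdot L n"
    unfolding zdot_def
    by (rule member_le_sum) (use assms in \<open>auto simp: Nvec_def pos_vec_def less_imp_le\<close>)
  finally show ?thesis .
qed

definition sublevel :: "real^'n \<Rightarrow> real \<Rightarrow> (int^'n) set" where
  "sublevel L T = {n \<in> Nvec. zdot L n \<le> T}"

text \<open>Each unit in a coordinate costs at least \<open>delay_min L\<close>, which bounds the
  coordinates separately. The box yields both finiteness and a polynomial count.\<close>

lemma sublevel_subset_box:
  assumes "L \<in> pos_vec"
  shows "sublevel L T \<subseteq> vec_lambda ` (PiE UNIV (\<lambda>_. {0..\<lfloor>T / delay_min L\<rfloor>}))"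
proof
  fix n assume n: "n \<in> sublevel L T"
  have "n $ i \<in> {0..\<lfloor>T / delay_min L\<rfloor>}" for i
  proof -
    have "delay_min L * real_of_int (n $ i) \<le> T"
      using zdot_ge_component[OF assms, of n i] n by (auto simp: sublevel_def)
    then have "real_of_int (n $ i) \<le> T / delay_min L"
      using delay_min_pos[OF assms] by (simp add: field_simps)
    then show ?thesis
      using n by (auto simp: sublevel_def Nvec_def le_floor_iff)
  qed
  then have "vec_nth n \<in> (PiE UNIV (\<lambda>_. {0..\<lfloor>T / delay_min L\<rfloor>}))"
    by auto
  then show "n \<in> vec_lambda ` (PiE UNIV (\<lambda>_. {0..\<lfloor>T / delay_min L\<rfloor>}))"
    by (rule rev_image_eqI) simp
qed

lemma finite_sublevel: "L \<in> pos_vec \<Longrightarrow> finite (sublevel L T)"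
  by (rule finite_subset[OF sublevel_subset_box]) (auto intro!: finite_PiE)

lemma card_sublevel_le:
  fixes L :: "real^'n"
  assumes L: "L \<in> pos_vec" and "0 \<le> T"
  shows "real (card (sublevel L T)) \<le> (1 + T / delay_min L) ^ CARD('n)"
proof -
  have "card (sublevel L T) \<le> card (vec_lambda ` (PiE (UNIV::'n set) (\<lambda>_. {0..\<lfloor>T / delay_min L\<rfloor>})))"
    by (rule card_mono[OF _ sublevel_subset_box[OF L]]) (auto intro!: finite_PiE)
  also have "\<dots> \<le> card (PiE (UNIV::'n set) (\<lambda>_. {0..\<lfloor>T / delay_min L\<rfloor>}))"
    by (rule card_image_le) (auto intro!: finite_PiE)
  also have "\<dots> = (nat (\<lfloor>T / delay_min L\<rfloor> + 1)) ^ CARD('n)"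
    by (simp add: card_PiE)
  finally have "real (card (sublevel L T)) \<le> real ((nat (\<lfloor>T / delay_min L\<rfloor> + 1)) ^ CARD('n))"
    by (rule of_nat_mono)
  also have "\<dots> = (real (nat (\<lfloor>T / delay_min L\<rfloor> + 1))) ^ CARD('n)"
    by simp
  also have "\<dots> \<le> (1 + T / delay_min L) ^ CARD('n)"
  proof (rule power_mono)
    have "0 \<le> T / delay_min L"
      using assms delay_min_pos[OF L] by simp
    then show "real (nat (\<lfloor>T / delay_min L\<rfloor> + 1)) \<le> 1 + T / delay_min L"
      by simp
  qed simp
  finally show ?thesis .
qed

text \<open>A single term of the exponential series is at most the whole series.\<close>

lemma pow_le_exp:
  fixes y :: real
  assumes "0 < \<delta>" "0 \<le> y"
  shows "y ^ m \<le> fact m / \<delta> ^ m * exp (\<delta> * y)"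
proof -
  have "(\<delta> * y) ^ m / fact m \<le> exp (\<delta> * y)"
  proof -
    have "(\<Sum>n\<in>{m}. (\<delta> * y) ^ n /\<^sub>R fact n) \<le> (\<Sum>n. (\<delta> * y) ^ n /\<^sub>R fact n)"
      using assms by (intro sum_le_suminf summable_exp_generic) auto
    then show ?thesis by (simp add: exp_def divide_inverse mult.commute)
  qed
  then show ?thesis
    using assms by (simp add: field_simps power_mult_distrib)
qed

text \<open>A polynomial count is absorbed by any growing exponential. The square is the loss
  incurred in \<open>Lp_norm_le_sum_translates\<close>.\<close>

lemma card_sublevel_subexponential:
  fixes L :: "real^'n"
  assumes L: "L \<in> pos_vec" and "0 < \<epsilon>"
  shows "\<exists>K>0. \<forall>t\<ge>0. (real (card (sublevel L (t + Lmax L))))\<^sup>2 \<le> K * exp (\<epsilon> * t)"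
proof -
  \<comment> \<open>The factor \<open>delay_min L\<close> cancels the denominator in
    \<open>y\<close> below, so that \<open>\<delta> * y\<close> is a constant plus
    \<open>\<epsilon> * t\<close>.\<close>
  define \<delta> where "\<delta> = \<epsilon> * delay_min L"
  have dpos: "0 < delay_min L" "0 < Lmax L" "0 < \<delta>"
    using delay_min_pos[OF L] Lmax_pos[OF L] \<open>0 < \<epsilon>\<close> by (auto simp: \<delta>_def)
  define m where "m = 2 * CARD('n)"
  define K where "K = fact m / \<delta> ^ m * exp (\<delta> * (1 + Lmax L / delay_min L))"
  have "(real (card (sublevel L (t + Lmax L))))\<^sup>2 \<le> K * exp (\<epsilon> * t)" if "0 \<le> t" for t
  proof -
    define y where "y = 1 + (t + Lmax L) / delay_min L"
    have "0 \<le> y" using dpos that by (simp add: y_def)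
    have "(real (card (sublevel L (t + Lmax L))))\<^sup>2 \<le> (y ^ CARD('n))\<^sup>2"
      using card_sublevel_le[OF L, of "t + Lmax L"] that dpos by (intro power_mono) (auto simp: y_def)
    also have "\<dots> = y ^ m"
      by (simp add: m_def mult.commute flip: power_mult)
    also have "\<dots> \<le> fact m / \<delta> ^ m * exp (\<delta> * y)"
      by (rule pow_le_exp) fact+
    also have "\<delta> * y = \<delta> * (1 + Lmax L / delay_min L) + \<epsilon> * t"
      using dpos by (simp add: y_def \<delta>_def field_simps)
    finally show ?thesis by (simp add: K_def exp_add)
  qed
  moreover have "0 < K" using dpos by (simp add: K_def)
  ultimately show ?thesis by blast
qed

section \<open>Explicit solutions\<close>

text \<open>A pointwise solution without exceptional times, to which solutions up to null sets are
  compared. The test on \<open>L\<close> makes the recursion total: for positive delays each step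
  lowers \<open>t / delay_min L\<close> by at least 1.\<close>

function sol :: "real^'n \<Rightarrow> (real \<Rightarrow> complex^'d^'d^'n) \<Rightarrow> (real \<Rightarrow> complex^'d)
    \<Rightarrow> real \<Rightarrow> complex^'d" where
  "sol L A v t =
     (if L \<notin> pos_vec \<or> t < 0 then v t else (\<Sum>j\<in>UNIV. (A t $ j) *v sol L A v (t - L $ j)))"
  by pat_completeness auto
termination
proof (relation "Wellfounded.measure (\<lambda>(L, A, v, t). nat (\<lfloor>t / delay_min L\<rfloor> + 1))", goal_cases)
  case (2 L A v t j)
  then have L: "L \<in> pos_vec" and t: "0 \<le> t" by auto
  have "(t - L $ j) / delay_min L \<le> t / delay_min L - 1"
    using delay_min_pos[OF L] delay_min_le[of L j] by (simp add: field_simps)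
  then have "\<lfloor>(t - L $ j) / delay_min L\<rfloor> \<le> \<lfloor>t / delay_min L - 1\<rfloor>"
    by (rule floor_mono)
  moreover have "0 \<le> \<lfloor>t / delay_min L\<rfloor>"
    using t delay_min_pos[OF L] by simp
  ultimately show ?case by simp
qed simp

declare sol.simps [simp del]

lemma sol_neg: "t < 0 \<Longrightarrow> sol L A v t = v t"
  by (simp add: sol.simps)

lemma sol_nonneg:
  "L \<in> pos_vec \<Longrightarrow> 0 \<le> t \<Longrightarrow> sol L A v t = (\<Sum>j\<in>UNIV. (A t $ j) *v sol L A v (t - L $ j))"
  by (subst sol.simps) simp

lemma matrix_vector_mult_sum:
  fixes M :: "complex^'m^'k"
  shows "M *v (\<Sum>i\<in>I. f i) = (\<Sum>i\<in>I. M *v f i)"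
  by (induction I rule: infinite_finite_induct) (auto simp: matrix_vector_right_distrib)

lemma sum_matrix_vector_mult:
  fixes f :: "'a \<Rightarrow> complex^'m^'k"
  shows "(\<Sum>i\<in>I. f i) *v x = (\<Sum>i\<in>I. f i *v x)"
  by (induction I rule: infinite_finite_induct) (auto simp: matrix_vector_mult_add_rdistrib)

lemma sum_matrix_mult_left:
  fixes f :: "'a \<Rightarrow> complex^'m^'k"
  shows "M ** (\<Sum>i\<in>I. f i) = (\<Sum>i\<in>I. M ** f i)"
  by (induction I rule: infinite_finite_induct) (auto simp: matrix_add_ldistrib)

lemma Xi_zero: "Xi L A 0 t = mat 1"
  by (simp add: Xi.simps)

lemma Xi_outside: "n \<notin> Nvec \<Longrightarrow> Xi L A n t = 0"
  by (simp add: Xi.simps)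

text \<open>\<open>Xi L A n t\<close> collects all orders of applying the delays counted by
  \<open>n\<close>, during which time stays nonnegative when \<open>n \<in> sublevel L t\<close>.
  The last delay \<open>j\<close> then crosses below 0 and reads the initial datum.\<close>

definition sol_term :: "real^'n \<Rightarrow> (real \<Rightarrow> complex^'d^'d^'n) \<Rightarrow> (real \<Rightarrow> complex^'d)
    \<Rightarrow> real \<Rightarrow> (int^'n) \<times> 'n \<Rightarrow> complex^'d" where
  "sol_term L A v t = (\<lambda>(n, j). if t < zdot L n + L $ j
     then Xi L A n t *v ((A (t - zdot L n) $ j) *v v (t - zdot L n - L $ j)) else 0)"

text \<open>Unrolling chooses the first delay \<open>k\<close>, and \<open>Xi\<close> obeys the same
  recursion in its first factor. Induction on the number of minimal delays fitting into
  \<open>t\<close> therefore closes after regrouping by \<open>n\<close>.\<close>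

lemma sol_representation:
  fixes L :: "real^'n"
  assumes L: "L \<in> pos_vec" and "0 \<le> t"
  shows "sol L A v t = (\<Sum>nj\<in>sublevel L t \<times> UNIV. sol_term L A v t nj)"
  using \<open>0 \<le> t\<close>
proof (induction "nat (\<lfloor>t / delay_min L\<rfloor> + 1)" arbitrary: t rule: less_induct)
  case less
  have dpos: "0 < delay_min L" by (rule delay_min_pos[OF L])
  have Lpos: "0 < L $ k" for k using L by (auto simp: pos_vec_def)
  \<comment> \<open>The part of \<open>sol_term\<close> to the right of \<open>Xi\<close>. It sees
    \<open>n\<close> and \<open>t\<close> only through \<open>t - zdot L n\<close>, so it is
    unchanged when \<open>n\<close> and \<open>t - L $ k\<close> are replaced by
    \<open>n + axis k 1\<close> and \<open>t\<close>.\<close>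
  define G where "G n j = (if t < zdot L n + L $ j
      then (A (t - zdot L n) $ j) *v v (t - zdot L n - L $ j) else 0)" for n j
  have IH: "sol L A v (t - L $ k) = (\<Sum>nj\<in>sublevel L (t - L $ k) \<times> UNIV. sol_term L A v (t - L $ k) nj)"
    if "L $ k \<le> t" for k
  proof (rule less.hyps)
    have "(t - L $ k) / delay_min L \<le> t / delay_min L - 1"
      using dpos delay_min_le[of L k] by (simp add: field_simps)
    then have "\<lfloor>(t - L $ k) / delay_min L\<rfloor> \<le> \<lfloor>t / delay_min L - 1\<rfloor>"
      by (rule floor_mono)
    moreover have "0 \<le> \<lfloor>t / delay_min L\<rfloor>"
      using less.prems dpos by simp
    ultimately show "nat (\<lfloor>(t - L $ k) / delay_min L\<rfloor> + 1) < nat (\<lfloor>t / delay_min L\<rfloor> + 1)"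
      by simp
  qed (use that in simp)
  have fin: "finite (sublevel L t)" by (rule finite_sublevel[OF L])
  define S where "S = sublevel L t - {0}"
  have zS: "0 \<in> sublevel L t" using less.prems by (simp add: sublevel_def)
  \<comment> \<open>One index set \<open>S\<close> for every \<open>k\<close> is what permits the
    later exchange of sums. At the surplus points \<open>n - axis k 1\<close> lies outside
    \<open>Nvec\<close>, where \<open>Xi\<close> vanishes; this also covers delays longer than
    \<open>t\<close>.\<close>
  have shifted: "(if L $ k \<le> t then sol L A v (t - L $ k) else 0)
      = (\<Sum>n\<in>S. \<Sum>j\<in>UNIV. Xi L A (n - axis k 1) (t - L $ k) *v G n j)" for k
  proof (cases "L $ k \<le> t")
    case True
    have "sol L A v (t - L $ k) = (\<Sum>n\<in>sublevel L (t - L $ k). \<Sum>j\<in>UNIV. sol_term L A v (t - L $ k) (n, j))"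
      using IH[OF True] by (simp add: sum.cartesian_product)
    also have "\<dots> = (\<Sum>n\<in>sublevel L (t - L $ k). \<Sum>j\<in>UNIV. Xi L A n (t - L $ k) *v G (n + axis k 1) j)"
      by (intro sum.cong refl) (auto simp: sol_term_def G_def zdot_add algebra_simps)
    also have "\<dots> = (\<Sum>n\<in>(\<lambda>n. n + axis k 1) ` sublevel L (t - L $ k). \<Sum>j\<in>UNIV. Xi L A (n - axis k 1) (t - L $ k) *v G n j)"
      by (subst sum.reindex) (auto simp: inj_on_def)
    also have "\<dots> = (\<Sum>n\<in>S. \<Sum>j\<in>UNIV. Xi L A (n - axis k 1) (t - L $ k) *v G n j)"
    proof (rule sum.mono_neutral_left)
      have "n + axis k 1 \<noteq> 0" if "n \<in> Nvec" for n :: "int^'n"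
      proof
        assume "n + axis k 1 = 0"
        then have "(n + axis k 1) $ k = 0" by simp
        then show False using that by (auto simp: Nvec_def axis_def dest: spec[of _ k])
      qed
      then show "(\<lambda>n. n + axis k 1) ` sublevel L (t - L $ k) \<subseteq> S"
        by (auto simp: S_def sublevel_def zdot_add)
      show "\<forall>n\<in>S - (\<lambda>n. n + axis k 1) ` sublevel L (t - L $ k). (\<Sum>j\<in>UNIV. Xi L A (n - axis k 1) (t - L $ k) *v G n j) = 0"
      proof
        fix n assume n: "n \<in> S - (\<lambda>n. n + axis k 1) ` sublevel L (t - L $ k)"
        have "n - axis k 1 \<notin> sublevel L (t - L $ k)"
          using n by (metis DiffE diff_add_cancel imageI)
        then have "n - axis k 1 \<notin> Nvec"
          using n by (auto simp: sublevel_def S_def zdot_diff)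
        then show "(\<Sum>j\<in>UNIV. Xi L A (n - axis k 1) (t - L $ k) *v G n j) = 0"
          by (simp add: Xi_outside)
      qed
    qed (use fin in \<open>simp add: S_def\<close>)
    finally show ?thesis using True by simp
  next
    case False
    have "n - axis k 1 \<notin> Nvec" if "n \<in> S" for n
    proof
      assume "n - axis k 1 \<in> Nvec"
      from zdot_nonneg[OF L this] show False
        using that False by (auto simp: zdot_diff S_def sublevel_def)
    qed
    then show ?thesis using False by (simp add: Xi_outside)
  qed
  have "sol L A v t = (\<Sum>k\<in>UNIV. A t $ k *v sol L A v (t - L $ k))"
    by (rule sol_nonneg[OF L less.prems])
  also have "\<dots> = (\<Sum>k\<in>UNIV. A t $ k *v (if t < L $ k then v (t - L $ k) else 0)
                    + A t $ k *v (if L $ k \<le> t then sol L A v (t - L $ k) else 0))"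
    by (intro sum.cong) (auto simp: sol_neg)
  \<comment> \<open>Delays leading directly below time 0 make up exactly the term
    \<open>n = 0\<close>, since \<open>G 0 k\<close> contains the same case distinction.\<close>
  also have "\<dots> = (\<Sum>k\<in>UNIV. Xi L A 0 t *v G 0 k)
      + (\<Sum>k\<in>UNIV. A t $ k *v (\<Sum>n\<in>S. \<Sum>j\<in>UNIV. Xi L A (n - axis k 1) (t - L $ k) *v G n j))"
    unfolding sum.distrib shifted by (intro arg_cong2[of _ _ _ _ "(+)"] sum.cong) (auto simp: G_def Xi_zero)
  also have "(\<Sum>k\<in>UNIV. A t $ k *v (\<Sum>n\<in>S. \<Sum>j\<in>UNIV. Xi L A (n - axis k 1) (t - L $ k) *v G n j))
      = (\<Sum>k\<in>UNIV. \<Sum>n\<in>S. \<Sum>j\<in>UNIV. (A t $ k ** Xi L A (n - axis k 1) (t - L $ k)) *v G n j)"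
    by (simp add: matrix_vector_mult_sum matrix_vector_mul_assoc)
  also have "\<dots> = (\<Sum>n\<in>S. \<Sum>j\<in>UNIV. \<Sum>k\<in>UNIV. (A t $ k ** Xi L A (n - axis k 1) (t - L $ k)) *v G n j)"
    by (subst sum.swap, rule sum.cong[OF refl], rule sum.swap)
  also have "\<dots> = (\<Sum>n\<in>S. \<Sum>j\<in>UNIV. Xi L A n t *v G n j)"
  proof (intro sum.cong refl)
    fix n j assume "n \<in> S"
    then have "Xi L A n t = (\<Sum>k\<in>UNIV. A t $ k ** Xi L A (n - axis k 1) (t - L $ k))"
      by (subst Xi.simps) (auto simp: S_def sublevel_def)
    then show "(\<Sum>k\<in>UNIV. (A t $ k ** Xi L A (n - axis k 1) (t - L $ k)) *v G n j) = Xi L A n t *v G n j"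
      by (simp add: sum_matrix_vector_mult)
  qed
  also have "(\<Sum>k\<in>UNIV. Xi L A 0 t *v G 0 k) + (\<Sum>n\<in>S. \<Sum>j\<in>UNIV. Xi L A n t *v G n j)
     = (\<Sum>n\<in>sublevel L t. \<Sum>j\<in>UNIV. Xi L A n t *v G n j)"
    unfolding S_def using zS fin by (simp add: sum.remove)
  also have "\<dots> = (\<Sum>nj\<in>sublevel L t \<times> UNIV. sol_term L A v t nj)"
    unfolding sum.cartesian_product
    by (intro sum.cong) (auto simp: sol_term_def G_def)
  finally show ?case .
qed

section \<open>The coefficients Theta\<close>

lemma zdot_eq_of_Vplus:
  assumes "L \<in> Vplus \<Lambda>" "zdot \<Lambda> m = zdot \<Lambda> n"
  shows "zdot L m = zdot L n"
proof -
  have "m - n \<in> Zset \<Lambda>" using assms by (simp add: Zset_def zdot_diff)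
  then have "m - n \<in> Zset L" using assms by (auto simp: Vplus_def)
  then show ?thesis by (simp add: Zset_def zdot_diff)
qed

lemma Wplus_subset_Vplus: "Wplus \<Lambda> \<subseteq> Vplus \<Lambda>"
  by (auto simp: Wplus_def Vplus_def)

lemma zdot_eq_of_Wplus:
  assumes "L \<in> Wplus \<Lambda>" "zdot L m = zdot L n"
  shows "zdot \<Lambda> m = zdot \<Lambda> n"
proof -
  have "m - n \<in> Zset L" using assms by (simp add: Zset_def zdot_diff)
  then have "m - n \<in> Zset \<Lambda>" using assms by (auto simp: Wplus_def)
  then show ?thesis by (simp add: Zset_def zdot_diff)
qed

lemma component_eq_of_Vplus:
  assumes "L \<in> Vplus \<Lambda>" "\<Lambda> $ i = \<Lambda> $ j"
  shows "L $ i = L $ j"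
  using zdot_eq_of_Vplus[OF assms(1), of "axis i 1" "axis j 1"] assms(2) by simp

text \<open>On \<open>Vplus \<Lambda>\<close> the indices of one class share their delay and the
  class of \<open>m - axis j 1\<close>. The chosen representative disappears and
  \<open>A_hat\<close> unfolds, which gives the index form matching the pairs of
  \<open>sol_term\<close>.\<close>

lemma Theta_eq_sum_indices:
  assumes LV: "L \<in> Vplus \<Lambda>"
  shows "Theta L \<Lambda> A m t = (\<Sum>j | zdot L m - L $ j \<le> t.
     Xi_hat L A (zclass \<Lambda> (m - axis j 1)) t ** (A (t - zdot L m + L $ j) $ j))"
proof -
  define rep :: "'a set \<Rightarrow> 'a" where "rep = (\<lambda>J. SOME j. j \<in> J)"
  have rep: "rep (index_class \<Lambda> j) \<in> index_class \<Lambda> j" for j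
    unfolding rep_def by (rule someI[of _ j]) (simp add: index_class_def)
  have Lrep: "L $ rep (index_class \<Lambda> j) = L $ j" for j
    by (rule component_eq_of_Vplus[OF LV]) (use rep[of j] in \<open>unfold index_class_def, blast\<close>)
  have zrep: "zclass \<Lambda> (m - axis (rep (index_class \<Lambda> j)) 1) = zclass \<Lambda> (m - axis j 1)" for j
  proof -
    have "\<Lambda> $ rep (index_class \<Lambda> j) = \<Lambda> $ j"
      using rep[of j] unfolding index_class_def by blast
    then show ?thesis by (simp add: zclass_def zdot_diff)
  qed
  define F where "F j = Xi_hat L A (zclass \<Lambda> (m - axis j 1)) t ** (A (t - zdot L m + L $ j) $ j)" for j
  define R where "R = {J \<in> range (index_class \<Lambda>). zdot L m - L $ rep J \<le> t}"
  have img: "index_class \<Lambda> ` {j. zdot L m - L $ j \<le> t} = R"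
    unfolding R_def by (auto simp: Lrep)
  have "Theta L \<Lambda> A m t = (\<Sum>J\<in>R. Xi_hat L A (zclass \<Lambda> (m - axis (rep J) 1)) t ** A_hat A J (t - zdot L m + L $ rep J))"
    by (simp add: Theta_def Let_def rep_def R_def)
  also have "\<dots> = (\<Sum>J\<in>R. \<Sum>j\<in>{j \<in> {j. zdot L m - L $ j \<le> t}. index_class \<Lambda> j = J}. F j)"
  proof (rule sum.cong[OF refl])
    fix J assume "J \<in> R"
    then obtain i where i: "J = index_class \<Lambda> i" "zdot L m - L $ i \<le> t"
      by (auto simp: R_def Lrep)
    have Jset: "{j \<in> {j. zdot L m - L $ j \<le> t}. index_class \<Lambda> j = J} = J"
    proof (intro set_eqI iffI)
      fix j assume "j \<in> J"
      then have j: "\<Lambda> $ j = \<Lambda> $ i" by (simp add: i index_class_def)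
      with i component_eq_of_Vplus[OF LV j] show "j \<in> {j \<in> {j. zdot L m - L $ j \<le> t}. index_class \<Lambda> j = J}"
        by (simp add: index_class_def)
    qed (auto simp: index_class_def)
    have "Xi_hat L A (zclass \<Lambda> (m - axis (rep J) 1)) t ** A_hat A J (t - zdot L m + L $ rep J)
        = (\<Sum>j\<in>J. Xi_hat L A (zclass \<Lambda> (m - axis i 1)) t ** (A (t - zdot L m + L $ i) $ j))"
      unfolding i(1) zrep Lrep A_hat_def sum_matrix_mult_left ..
    also have "\<dots> = (\<Sum>j\<in>J. F j)"
    proof (rule sum.cong[OF refl])
      fix j assume "j \<in> J"
      then have "\<Lambda> $ j = \<Lambda> $ i" by (simp add: i index_class_def)
      moreover from this have "L $ j = L $ i" by (rule component_eq_of_Vplus[OF LV])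
      ultimately show "Xi_hat L A (zclass \<Lambda> (m - axis i 1)) t ** (A (t - zdot L m + L $ i) $ j) = F j"
        by (simp add: F_def zclass_def zdot_diff)
    qed
    finally show "Xi_hat L A (zclass \<Lambda> (m - axis (rep J) 1)) t ** A_hat A J (t - zdot L m + L $ rep J)
       = (\<Sum>j\<in>{j \<in> {j. zdot L m - L $ j \<le> t}. index_class \<Lambda> j = J}. F j)"
      unfolding Jset .
  qed
  also have "\<dots> = (\<Sum>j | zdot L m - L $ j \<le> t. F j)"
    unfolding img[symmetric] by (rule sum.image_gen[symmetric]) simp
  finally show ?thesis unfolding F_def .
qed

text \<open>By \<open>Vplus\<close>, all pairs with \<open>n + axis j 1\<close> in the
  \<open>\<Lambda>\<close>-class of \<open>m\<close> read \<open>v\<close> at the one point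
  \<open>t - zdot L m\<close>, and the matrices in front add up to \<open>Theta\<close>. For them
  \<open>zdot L n \<le> t\<close> says \<open>zdot L m - L $ j \<le> t\<close>, the condition in the
  sum that defines \<open>Theta\<close>.\<close>

lemma sum_sol_term_class:
  assumes LV: "L \<in> Vplus \<Lambda>" and \<Lambda>: "\<Lambda> \<in> pos_vec" and tm: "t < zdot L m"
  shows "(\<Sum>(n, j) | (n, j) \<in> sublevel L t \<times> UNIV \<and> zdot \<Lambda> n + \<Lambda> $ j = zdot \<Lambda> m.
            sol_term L A v t (n, j))
       = Theta L \<Lambda> A m t *v v (t - zdot L m)"
proof -
  have L: "L \<in> pos_vec" using LV by (simp add: Vplus_def)
  have key: "zdot L n + L $ j = zdot L m" if "zdot \<Lambda> n + \<Lambda> $ j = zdot \<Lambda> m" for n j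
    using zdot_eq_of_Vplus[OF LV, of "n + axis j 1" m] that by (simp add: zdot_add)
  have key_le: "zdot L m \<le> t + L $ j" if "zdot \<Lambda> n + \<Lambda> $ j = zdot \<Lambda> m" "zdot L n \<le> t" for n j
    using key[OF that(1)] that(2) by simp
  \<comment> \<open>The classes are those of \<open>\<Lambda>\<close>, so the positivity of
    \<open>\<Lambda>\<close> itself makes them finite within \<open>Nvec\<close>.\<close>
  have fin: "finite (zclass \<Lambda> k \<inter> Nvec)" for k
    by (rule finite_subset[OF _ finite_sublevel[OF \<Lambda>, of "zdot \<Lambda> k"]]) (auto simp: zclass_def sublevel_def)
  have "Theta L \<Lambda> A m t *v v (t - zdot L m) =
     (\<Sum>j | zdot L m - L $ j \<le> t. \<Sum>n\<in>zclass \<Lambda> (m - axis j 1) \<inter> Nvec.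
        Xi L A n t *v ((A (t - zdot L m + L $ j) $ j) *v v (t - zdot L m)))"
    unfolding Theta_eq_sum_indices[OF LV] Xi_hat_def
    by (simp add: sum_matrix_vector_mult flip: matrix_vector_mul_assoc)
  also have "\<dots> = (\<Sum>j | zdot L m - L $ j \<le> t. \<Sum>n\<in>zclass \<Lambda> (m - axis j 1) \<inter> Nvec. sol_term L A v t (n, j))"
  proof (intro sum.cong refl)
    fix j n assume "n \<in> zclass \<Lambda> (m - axis j 1) \<inter> Nvec"
    then have "zdot L n + L $ j = zdot L m"
      by (intro key) (simp add: zclass_def zdot_diff)
    then have e: "zdot L n = zdot L m - L $ j" by simp
    show "Xi L A n t *v ((A (t - zdot L m + L $ j) $ j) *v v (t - zdot L m)) = sol_term L A v t (n, j)"
      using tm by (simp add: sol_term_def e algebra_simps)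
  qed
  also have "\<dots> = (\<Sum>(j, n)\<in>(SIGMA j:{j. zdot L m - L $ j \<le> t}. zclass \<Lambda> (m - axis j 1) \<inter> Nvec). sol_term L A v t (n, j))"
    by (rule sum.Sigma) (use fin in auto)
  also have "\<dots> = (\<Sum>(n, j) | (n, j) \<in> sublevel L t \<times> UNIV \<and> zdot \<Lambda> n + \<Lambda> $ j = zdot \<Lambda> m.
            sol_term L A v t (n, j))"
    by (rule sum.reindex_bij_witness[where i = prod.swap and j = prod.swap])
       (auto simp: zclass_def zdot_diff sublevel_def algebra_simps dest: key key_le)
  finally show ?thesis by simp
qed

section \<open>Matrices and their norms\<close>

lemma bounded_bilinear_matrix_vector:
  "bounded_bilinear (\<lambda>(M::complex^'m^'k) (x::complex^'m). M *v x)"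
  unfolding bilinear_conv_bounded_bilinear[symmetric] bilinear_def
  by (auto intro!: linearI simp: matrix_vector_right_distrib matrix_vector_mult_add_rdistrib
      vec_eq_iff matrix_vector_mult_def scaleR_sum_right algebra_simps sum.distrib)

lemma bounded_bilinear_matrix_mult:
  "bounded_bilinear (\<lambda>(M::complex^'m^'k) (P::complex^'l^'m). M ** P)"
  unfolding bilinear_conv_bounded_bilinear[symmetric] bilinear_def
  by (auto intro!: linearI simp: vec_eq_iff matrix_matrix_mult_def scaleR_sum_right
      algebra_simps sum.distrib)

lemma matrix_norm_scaleR:
  assumes "matrix_norm \<nu>"
  shows "\<nu> (r *\<^sub>R M) = \<bar>r\<bar> * \<nu> M"
proof -
  have "r *\<^sub>R M = (\<chi> i j. complex_of_real r * M $ i $ j)"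
    unfolding vec_eq_iff vector_scaleR_component vec_lambda_beta scaleR_conv_of_real[where 'a = complex]
    by simp
  then show ?thesis using assms by (simp add: matrix_norm_def)
qed

lemma matrix_norm_continuous_bound:
  fixes \<nu> :: "complex^'d^'d \<Rightarrow> real"
  assumes "matrix_norm \<nu>"
  shows "\<exists>C>0. \<forall>M. \<nu> M \<le> C * norm M"
proof -
  note scale = matrix_norm_scaleR[OF assms]
  have nn: "0 \<le> \<nu> M" for M using assms by (simp add: matrix_norm_def)
  have tri: "\<nu> (M + P) \<le> \<nu> M + \<nu> P" for M P using assms by (simp add: matrix_norm_def)
  have z: "\<nu> 0 = 0" using assms by (simp add: matrix_norm_def)
  have tri_sum: "\<nu> (\<Sum>i\<in>I. f i) \<le> (\<Sum>i\<in>I. \<nu> (f i))" for I :: "(complex^'d^'d) set" and f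
    by (induction I rule: infinite_finite_induct) (auto simp: z intro: order.trans[OF tri])
  define C where "C = 1 + (\<Sum>b\<in>Basis. \<nu> b)"
  have "\<nu> M \<le> C * norm M" for M
  proof -
    have "\<nu> M = \<nu> (\<Sum>b\<in>Basis. (M \<bullet> b) *\<^sub>R b)" by (simp add: euclidean_representation)
    also have "\<dots> \<le> (\<Sum>b\<in>Basis. \<bar>M \<bullet> b\<bar> * \<nu> b)"
      by (rule order.trans[OF tri_sum]) (simp add: scale)
    also have "\<dots> \<le> (\<Sum>b\<in>Basis. norm M * \<nu> b)"
      by (intro sum_mono mult_right_mono Basis_le_norm nn)
    also have "\<dots> \<le> C * norm M" by (simp add: C_def algebra_simps flip: sum_distrib_left)
    finally show ?thesis .
  qed
  moreover have "0 < C" unfolding C_def by (intro add_pos_nonneg sum_nonneg nn) auto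
  ultimately show ?thesis by blast
qed

lemma continuous_matrix_norm:
  fixes \<nu> :: "complex^'d^'d \<Rightarrow> real"
  assumes "matrix_norm \<nu>"
  shows "continuous_on UNIV \<nu>"
proof -
  obtain C where C: "C > 0" "\<And>M. \<nu> M \<le> C * norm M"
    using matrix_norm_continuous_bound[OF assms] by blast
  have tri: "\<nu> (M + P) \<le> \<nu> M + \<nu> P" for M P using assms by (simp add: matrix_norm_def)
  have le: "\<nu> M \<le> \<nu> P + C * norm (M - P)" for M P
    using tri[of P "M - P"] C(2)[of "M - P"] by simp
  have "C-lipschitz_on UNIV \<nu>"
  proof (rule lipschitz_onI)
    fix M P
    show "dist (\<nu> M) (\<nu> P) \<le> C * dist M P"
      using le[of M P] le[of P M] by (simp add: dist_real_def dist_norm norm_minus_commute abs_le_iff)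
  qed (use C in simp)
  then show ?thesis by (rule lipschitz_on_continuous_on)
qed

text \<open>The lower constant is the minimum on the compact unit sphere. Products are estimated in
  the Euclidean norm, and this equivalence carries the results over to \<open>\<nu>\<close>.\<close>

lemma matrix_norm_equivalent:
  fixes \<nu> :: "complex^'d^'d \<Rightarrow> real"
  assumes "matrix_norm \<nu>"
  shows "\<exists>C>0. \<forall>M. \<nu> M \<le> C * norm M \<and> norm M \<le> C * \<nu> M"
proof -
  obtain C where C: "C > 0" "\<And>M. \<nu> M \<le> C * norm M"
    using matrix_norm_continuous_bound[OF assms] by blast
  note scale = matrix_norm_scaleR[OF assms]
  have "continuous_on (sphere 0 1) \<nu>"
    using continuous_matrix_norm[OF assms] by (rule continuous_on_subset) simp
  moreover have "compact (sphere (0::complex^'d^'d) 1)" "sphere (0::complex^'d^'d) 1 \<noteq> {}"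
    by auto
  ultimately obtain M0 where M0: "M0 \<in> sphere 0 1" "\<And>M. M \<in> sphere 0 1 \<Longrightarrow> \<nu> M0 \<le> \<nu> M"
    by (metis continuous_attains_inf)
  have "M0 \<noteq> 0" using M0(1) by auto
  then have pos: "0 < \<nu> M0" using assms by (auto simp: matrix_norm_def less_le)
  have "norm M \<le> (1 / \<nu> M0) * \<nu> M" for M
  proof (cases "M = 0")
    case False
    have "\<nu> M0 \<le> \<nu> ((1 / norm M) *\<^sub>R M)" using False by (intro M0(2)) simp
    then show ?thesis unfolding scale using False pos by (simp add: field_simps)
  qed (use assms in \<open>simp add: matrix_norm_def\<close>)
  then have "norm M \<le> max C (1 / \<nu> M0) * \<nu> M" for M
    by (rule order.trans) (use assms in \<open>intro mult_right_mono, auto simp: matrix_norm_def\<close>)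
  moreover have "\<nu> M \<le> max C (1 / \<nu> M0) * norm M" for M
    by (rule order.trans[OF C(2)]) (auto intro!: mult_right_mono)
  ultimately show ?thesis using C(1) by (intro exI[of _ "max C (1 / \<nu> M0)"]) auto
qed

text \<open>The test data of the converse point along basis vectors and so control only columns;
  this bound recovers the matrix.\<close>

lemma norm_matrix_le_sum_columns:
  "norm (M :: complex^'d^'k) \<le> (\<Sum>i\<in>UNIV. norm (M *v axis i 1))"
proof -
  have col: "(M *v axis i 1) $ k = M $ k $ i" for i k
  proof -
    have "(M *v axis i 1) $ k = (\<Sum>j\<in>UNIV. if j = i then M $ k $ j else 0)"
      unfolding matrix_vector_mult_def vec_lambda_beta by (intro sum.cong) (auto simp: axis_def)
    then show ?thesis by simp
  qed
  have "M = (\<Sum>i\<in>UNIV. \<chi> k j. if j = i then M $ k $ j else 0)"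
    by (simp add: vec_eq_iff)
  then have "norm M \<le> (\<Sum>i\<in>UNIV. norm (\<chi> k j. if j = i then M $ k $ j else 0))"
    by (metis (no_types) norm_sum)
  also have "\<dots> = (\<Sum>i\<in>UNIV. norm (M *v axis i 1))"
  proof (rule sum.cong[OF refl])
    fix i
    have "norm (\<chi> j. if j = i then M $ k $ j else 0) = norm (M $ k $ i)" for k
    proof -
      have "(\<Sum>j\<in>UNIV. (norm (if j = i then M $ k $ j else 0))\<^sup>2)
          = (\<Sum>j\<in>UNIV. if j = i then (norm (M $ k $ j))\<^sup>2 else 0)"
        by (rule sum.cong) auto
      then show ?thesis by (simp add: norm_vec_def L2_set_def)
    qed
    then show "norm (\<chi> k j. if j = i then M $ k $ j else 0) = norm (M *v axis i 1)"
      by (simp add: norm_vec_def col)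
  qed
  finally show ?thesis .
qed

section \<open>Translations of Lebesgue measure\<close>

lemma measurable_translate [measurable]: "(\<lambda>x::real. x + c) \<in> lebesgue \<rightarrow>\<^sub>M lebesgue"
  using lebesgue_affine_measurable[where c = "\<lambda>x::real. 1" and t = c] by (simp add: add.commute)

lemma measurable_translate_minus [measurable]: "(\<lambda>x::real. x - c) \<in> lebesgue \<rightarrow>\<^sub>M lebesgue"
  using measurable_translate[of "- c"] by simp

lemma distr_lebesgue_translate: "distr lebesgue lebesgue (\<lambda>x::real. x + c) = lebesgue"
  using lebesgue_real_affine[of 1 c] by (simp add: density_1 add.commute)

lemma AE_lebesgue_translate:
  assumes "AE x in lebesgue. P (x::real)"
  shows "AE x in lebesgue. P (x + c)"
  by (rule AE_distrD[OF measurable_translate]) (unfold distr_lebesgue_translate, fact assms)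

lemma AE_lebesgue_translate_minus:
  assumes "AE x in lebesgue. P (x::real)"
  shows "AE x in lebesgue. P (x - c)"
  using AE_lebesgue_translate[OF assms, of "- c"] by simp

lemma nn_integral_translate:
  assumes [measurable]: "f \<in> borel_measurable lebesgue"
  shows "(\<integral>\<^sup>+x. f (x + c :: real) \<partial>lebesgue) = (\<integral>\<^sup>+x. f x \<partial>lebesgue)"
proof -
  have "(\<integral>\<^sup>+x. f x \<partial>distr lebesgue lebesgue (\<lambda>x::real. x + c)) = (\<integral>\<^sup>+x. f (x + c) \<partial>lebesgue)"
    by (rule nn_integral_distr) measurable
  then show ?thesis by (simp add: distr_lebesgue_translate)
qed

lemma measurable_comp_translate:
  assumes "f \<in> borel_measurable lebesgue"
  shows "(\<lambda>x::real. f (x + c)) \<in> borel_measurable lebesgue"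
  using measurable_compose[OF measurable_translate assms] .

lemma measurable_comp_translate_minus:
  assumes "f \<in> borel_measurable lebesgue"
  shows "(\<lambda>x::real. f (x - c)) \<in> borel_measurable lebesgue"
  using measurable_compose[OF measurable_translate_minus assms] .

lemma AE_lebesgue_on_iff:
  "I \<in> sets lebesgue \<Longrightarrow> (AE x in lebesgue_on I. P x) \<longleftrightarrow> (AE x in lebesgue. x \<in> I \<longrightarrow> P x)"
  by (rule AE_restrict_space_iff) simp

section \<open>Lebesgue norms\<close>

lemma ennroot_mono:
  assumes "0 < q" "x \<le> y" shows "ennroot q x \<le> ennroot q y"
proof (cases "y = \<infinity>")
  case False
  then have "x \<noteq> \<infinity>" using assms by (auto simp: top_unique)
  moreover have "enn2real x \<le> enn2real y"
    using assms False by (simp add: enn2real_mono less_top)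
  ultimately show ?thesis
    using False assms by (auto simp: ennroot_def intro!: ennreal_leI powr_mono2)
qed (simp add: ennroot_def)

lemma ennroot_mult:
  assumes "0 < q" "0 \<le> c"
  shows "ennroot q (ennreal (c powr q) * x) = ennreal c * ennroot q x"
proof (cases "x = \<infinity>")
  case True
  then show ?thesis using assms
    by (cases "c = 0") (auto simp: ennroot_def ennreal_mult_top)
next
  case False
  then obtain r where "x = ennreal r" "0 \<le> r" by (cases x) auto
  then show ?thesis using assms
    by (auto simp: ennroot_def ennreal_mult'[symmetric] powr_mult powr_powr simp flip: ennreal_mult)
qed

text \<open>Measurability of \<open>g\<close> is a conclusion, by completeness of Lebesgue measure:
  a solution is known only up to null sets and inherits it from \<open>sol\<close>.\<close>

lemma Lp_norm_cong:
  fixes f g :: "real \<Rightarrow> 'a::euclidean_space"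
  assumes I: "I \<in> sets lebesgue" and f: "f \<in> borel_measurable (lebesgue_on I)"
    and ae: "AE s in lebesgue. s \<in> I \<longrightarrow> f s = g s"
  shows "g \<in> borel_measurable (lebesgue_on I)" "Lp_norm p I f = Lp_norm p I g"
proof -
  have "(\<lambda>x. if x \<in> I then f x else 0) \<in> borel_measurable lebesgue"
    using I f by (simp add: borel_measurable_if)
  moreover have "AE x in lebesgue. (if x \<in> I then f x else 0) = (if x \<in> I then g x else 0)"
    using ae by eventually_elim auto
  ultimately have "(\<lambda>x. if x \<in> I then g x else 0) \<in> borel_measurable lebesgue"
    by (rule borel_measurable_AE)
  then show g: "g \<in> borel_measurable (lebesgue_on I)"
    using I by (simp add: borel_measurable_if)
  have ae': "AE s in lebesgue_on I. f s = g s"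
    using ae I by (simp add: AE_lebesgue_on_iff)
  have "esssup (lebesgue_on I) (\<lambda>s. ennreal (norm (f s))) = esssup (lebesgue_on I) (\<lambda>s. ennreal (norm (g s)))"
    by (rule esssup_AE_cong) (use f g ae' in \<open>auto intro: eventually_mono\<close>)
  moreover have "(\<integral>\<^sup>+ s. ennreal (norm (f s) powr enn2real p) \<partial>lebesgue_on I)
      = (\<integral>\<^sup>+ s. ennreal (norm (g s) powr enn2real p) \<partial>lebesgue_on I)"
    by (rule nn_integral_cong_AE) (use ae' in \<open>auto intro: eventually_mono\<close>)
  ultimately show "Lp_norm p I f = Lp_norm p I g"
    by (simp add: Lp_norm_def)
qed

text \<open>The sum is at most \<open>card S\<close> times its largest term, and the power of that
  term occurs on the right. The crude factor is harmless because \<open>card S\<close> will grow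
  only polynomially.\<close>

lemma sum_powr_le:
  fixes w :: "'i \<Rightarrow> real"
  assumes S: "finite S" "S \<noteq> {}" and w: "\<And>i. i \<in> S \<Longrightarrow> 0 \<le> w i" and q: "1 \<le> q"
  shows "(\<Sum>i\<in>S. w i) powr q \<le> real (card S) powr q * (\<Sum>i\<in>S. w i powr q)"
proof -
  define m where "m = Max (w ` S)"
  have "m \<in> w ` S" unfolding m_def using S by (intro Max_in) auto
  then obtain i where i: "i \<in> S" "m = w i" by auto
  have le: "w j \<le> m" if "j \<in> S" for j unfolding m_def using S that by (intro Max_ge) auto
  have "(\<Sum>i\<in>S. w i) \<le> real (card S) * m"
    using sum_bounded_above[of S w m] le by simp
  then have "(\<Sum>i\<in>S. w i) powr q \<le> (real (card S) * m) powr q"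
    using q w by (intro powr_mono2 sum_nonneg) auto
  also have "\<dots> = real (card S) powr q * m powr q"
    using i w by (simp add: powr_mult)
  also have "m powr q \<le> (\<Sum>i\<in>S. w i powr q)"
    unfolding i(2) using S i by (intro member_le_sum) auto
  finally show ?thesis by (simp add: mult_left_mono)
qed

text \<open>One constant serves every \<open>p\<close>. For a finite exponent \<open>q\<close>, the
  power of the sum costs \<open>card S\<close> to the power \<open>q\<close>, and adding equal
  integrals costs one more factor \<open>card S\<close>. As \<open>card S\<close> is at least 1,
  both fit into the \<open>q\<close>-th power of its square.\<close>

lemma Lp_norm_le_sum_translates:
  fixes f :: "real \<Rightarrow> 'a::euclidean_space" and g :: "real \<Rightarrow> 'b::euclidean_space"
  assumes I: "I \<in> sets lebesgue" and f: "f \<in> borel_measurable (lebesgue_on I)"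
    and J: "J \<in> sets lebesgue" and g: "g \<in> borel_measurable lebesgue"
    and g0: "\<And>s. s \<notin> J \<Longrightarrow> g s = 0"
    and S: "finite S" "S \<noteq> {}" and b: "0 \<le> b" and p: "1 \<le> p"
    and ae: "AE s in lebesgue. s \<in> I \<longrightarrow> norm (f s) \<le> b * (\<Sum>n\<in>S. norm (g (s + \<tau> n)))"
  shows "Lp_norm p I f \<le> ennreal (b * (real (card S))\<^sup>2) * Lp_norm p J g"
proof -
  define M where "M = real (card S)"
  have M: "1 \<le> M" using S by (simp add: M_def Suc_le_eq card_gt_0_iff)
  have Msq: "M \<le> M\<^sup>2" using M by (simp add: power2_eq_square)
  show ?thesis
  proof (cases "p = \<infinity>")
    case True
    define W where "W = esssup (lebesgue_on J) (\<lambda>s. ennreal (norm (g s)))"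
    have "AE s in lebesgue. s \<in> J \<longrightarrow> ennreal (norm (g s)) \<le> W"
      using esssup_AE[of "\<lambda>s. ennreal (norm (g s))" "lebesgue_on J"] J
      by (simp add: AE_lebesgue_on_iff W_def)
    then have gW: "AE s in lebesgue. ennreal (norm (g s)) \<le> W"
      by eventually_elim (use g0 in force)
    have "AE s in lebesgue. ennreal (norm (g (s + \<tau> n))) \<le> W" for n
      by (rule AE_lebesgue_translate[OF gW])
    then have "AE s in lebesgue. \<forall>n\<in>S. ennreal (norm (g (s + \<tau> n))) \<le> W"
      using S(1) by (simp add: AE_finite_all)
    with ae have "AE s in lebesgue. s \<in> I \<longrightarrow> ennreal (norm (f s)) \<le> ennreal (b * M\<^sup>2) * W"
    proof eventually_elim
      case (elim s)
      show ?case
      proof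
        assume "s \<in> I"
        with elim have "ennreal (norm (f s)) \<le> ennreal (b * (\<Sum>n\<in>S. norm (g (s + \<tau> n))))"
          by (auto intro: ennreal_leI)
        also have "\<dots> = ennreal b * (\<Sum>n\<in>S. ennreal (norm (g (s + \<tau> n))))"
          using b by (simp add: ennreal_mult sum_nonneg)
        also have "\<dots> \<le> ennreal b * (\<Sum>n\<in>S. W)"
          using elim by (intro mult_left_mono sum_mono) auto
        also have "\<dots> = ennreal (b * M) * W"
          using b by (simp add: M_def ennreal_mult ennreal_of_nat_eq_real_of_nat mult.assoc)
        also have "\<dots> \<le> ennreal (b * M\<^sup>2) * W"
          using b Msq by (intro mult_right_mono ennreal_leI mult_left_mono) auto
        finally show "ennreal (norm (f s)) \<le> ennreal (b * M\<^sup>2) * W" .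
      qed
    qed
    then have "esssup (lebesgue_on I) (\<lambda>s. ennreal (norm (f s))) \<le> ennreal (b * M\<^sup>2) * W"
      using f I by (intro esssup_I) (auto simp: AE_lebesgue_on_iff)
    then show ?thesis using True by (simp add: Lp_norm_def W_def M_def)
  next
    case False
    define q where "q = enn2real p"
    have q: "1 \<le> q"
      using p False enn2real_mono[of 1 p] by (simp add: q_def less_top)
    have gm [measurable]: "(\<lambda>s. ennreal (norm (g s) powr q)) \<in> borel_measurable lebesgue"
      using g by measurable
    have gm' [measurable]: "(\<lambda>s. ennreal (norm (g (s + \<tau> n)) powr q)) \<in> borel_measurable lebesgue" for n
      using measurable_comp_translate[OF gm] .
    \<comment> \<open>As \<open>g\<close> vanishes off \<open>J\<close>, its integrals over
      \<open>J\<close> and over the line agree, and the latter are translation invariant.\<close>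
    define G where "G = (\<integral>\<^sup>+ s. ennreal (norm (g s) powr q) \<partial>lebesgue)"
    have GJ: "G = (\<integral>\<^sup>+ s. ennreal (norm (g s) powr q) \<partial>lebesgue_on J)"
      unfolding G_def using J by (subst nn_integral_restrict_space) (auto intro!: nn_integral_cong simp: indicator_def g0)
    have "(\<integral>\<^sup>+ s. ennreal (norm (f s) powr q) \<partial>lebesgue_on I)
       \<le> (\<integral>\<^sup>+ s. ennreal ((b * M) powr q) * (\<Sum>n\<in>S. ennreal (norm (g (s + \<tau> n)) powr q)) \<partial>lebesgue)"
    proof (subst nn_integral_restrict_space)
      show "(\<integral>\<^sup>+ s. ennreal (norm (f s) powr q) * indicator I s \<partial>lebesgue)
       \<le> (\<integral>\<^sup>+ s. ennreal ((b * M) powr q) * (\<Sum>n\<in>S. ennreal (norm (g (s + \<tau> n)) powr q)) \<partial>lebesgue)"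
      proof (rule nn_integral_mono_AE)
        show "AE s in lebesgue. ennreal (norm (f s) powr q) * indicator I s
           \<le> ennreal ((b * M) powr q) * (\<Sum>n\<in>S. ennreal (norm (g (s + \<tau> n)) powr q))"
          using ae
        proof eventually_elim
          case (elim s)
          show ?case
          proof (cases "s \<in> I")
            case True
            with elim have "norm (f s) powr q \<le> (b * (\<Sum>n\<in>S. norm (g (s + \<tau> n)))) powr q"
              using q by (intro powr_mono2) auto
            also have "\<dots> = b powr q * (\<Sum>n\<in>S. norm (g (s + \<tau> n))) powr q"
              using b by (simp add: powr_mult sum_nonneg)
            also have "\<dots> \<le> b powr q * (M powr q * (\<Sum>n\<in>S. norm (g (s + \<tau> n)) powr q))"
              unfolding M_def using S q by (intro mult_left_mono sum_powr_le) auto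
            also have "\<dots> = (b * M) powr q * (\<Sum>n\<in>S. norm (g (s + \<tau> n)) powr q)"
              using b M by (simp add: powr_mult)
            finally have "ennreal (norm (f s) powr q) \<le> ennreal ((b * M) powr q * (\<Sum>n\<in>S. norm (g (s + \<tau> n)) powr q))"
              by (rule ennreal_leI)
            then show ?thesis using True by (simp add: ennreal_mult sum_nonneg)
          qed simp
        qed
      qed
    qed (use I in simp)
    also have "\<dots> = ennreal ((b * M) powr q) * (\<Sum>n\<in>S. (\<integral>\<^sup>+ s. ennreal (norm (g (s + \<tau> n)) powr q) \<partial>lebesgue))"
      by (subst nn_integral_cmult, measurable, subst nn_integral_sum) (rule gm', rule refl)
    also have "\<dots> = ennreal ((b * M) powr q) * (\<Sum>n\<in>S. G)"
      unfolding G_def by (subst nn_integral_translate[OF gm]) simp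
    also have "\<dots> = ennreal ((b * M) powr q * M) * G"
      using M by (simp add: M_def ennreal_mult ennreal_of_nat_eq_real_of_nat mult.assoc)
    also have "\<dots> \<le> ennreal ((b * M\<^sup>2) powr q) * G"
    proof (intro mult_right_mono ennreal_leI)
      have "(b * M) powr q * M \<le> (b * M) powr q * M powr q"
        using M q powr_mono[of 1 q M] by (intro mult_left_mono) auto
      also have "\<dots> = (b * M\<^sup>2) powr q"
        using M b by (simp add: power2_eq_square powr_mult mult.assoc)
      finally show "(b * M) powr q * M \<le> (b * M\<^sup>2) powr q" .
    qed simp
    finally have "ennroot q (\<integral>\<^sup>+ s. ennreal (norm (f s) powr q) \<partial>lebesgue_on I)
        \<le> ennroot q (ennreal ((b * M\<^sup>2) powr q) * G)"
      using q by (intro ennroot_mono) auto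
    also have "\<dots> = ennreal (b * M\<^sup>2) * ennroot q G"
      using q b by (intro ennroot_mult) auto
    finally show ?thesis
      using False by (simp add: Lp_norm_def M_def GJ q_def)
  qed
qed

text \<open>The estimate by translates, for the single translation by 0.\<close>

lemma Lp_norm_scaleR_le:
  fixes f :: "real \<Rightarrow> 'a::euclidean_space"
  assumes I: "I \<in> sets lebesgue" and f: "f \<in> borel_measurable (lebesgue_on I)" and p: "1 \<le> p"
    and c: "0 \<le> c"
  shows "Lp_norm p I (\<lambda>s. c *\<^sub>R f s) \<le> ennreal c * Lp_norm p I f"
proof -
  define g where "g s = (if s \<in> I then f s else 0)" for s
  have g: "g \<in> borel_measurable lebesgue"
    unfolding g_def using I f by (simp add: borel_measurable_if)
  have "Lp_norm p I (\<lambda>s. c *\<^sub>R f s) \<le> ennreal (c * (real (card {()}))\<^sup>2) * Lp_norm p I g"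
    by (rule Lp_norm_le_sum_translates[where \<tau> = "\<lambda>_. 0"]) (use I f g p c in \<open>auto simp: g_def\<close>)
  also have "Lp_norm p I g = Lp_norm p I f"
    by (rule Lp_norm_cong(2)[OF I f, symmetric]) (simp add: g_def)
  finally show ?thesis by simp
qed

lemma Lp_norm_scaleR:
  fixes f :: "real \<Rightarrow> 'a::euclidean_space"
  assumes I: "I \<in> sets lebesgue" and f: "f \<in> borel_measurable (lebesgue_on I)" and p: "1 \<le> p"
    and c: "0 < c"
  shows "Lp_norm p I (\<lambda>s. c *\<^sub>R f s) = ennreal c * Lp_norm p I f"
proof (rule antisym)
  have "Lp_norm p I (\<lambda>s. (1 / c) *\<^sub>R c *\<^sub>R f s) \<le> ennreal (1 / c) * Lp_norm p I (\<lambda>s. c *\<^sub>R f s)"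
    using I f p c by (intro Lp_norm_scaleR_le) auto
  then have "ennreal c * Lp_norm p I f \<le> ennreal c * (ennreal (1 / c) * Lp_norm p I (\<lambda>s. c *\<^sub>R f s))"
    using c by (intro mult_left_mono) auto
  also have "\<dots> = Lp_norm p I (\<lambda>s. c *\<^sub>R f s)"
    using c by (simp add: mult.assoc[symmetric] flip: ennreal_mult)
  finally show "ennreal c * Lp_norm p I f \<le> Lp_norm p I (\<lambda>s. c *\<^sub>R f s)" .
qed (use assms in \<open>auto intro: Lp_norm_scaleR_le\<close>)

text \<open>The contradiction behind the converse: \<open>f\<close> will be a solution segment and
  \<open>g\<close> a unit vector on a translate \<open>Y\<close> of the set \<open>X\<close> where
  \<open>f\<close> is too large. With \<open>r\<close> the \<open>q\<close>-th root of the common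
  measure, the norms give \<open>2 * c * r \<le> c * r\<close>, so \<open>r = 0\<close>. In the
  supremum norm \<open>g\<close> has norm at most 1, so almost no point can lie in
  \<open>X\<close>.\<close>

lemma null_of_Lp_norm_le:
  fixes f :: "real \<Rightarrow> 'a::euclidean_space" and g :: "real \<Rightarrow> 'b::euclidean_space"
  assumes I: "I \<in> sets lebesgue" and X: "X \<in> sets lebesgue" "X \<subseteq> I" and Y: "Y \<in> sets lebesgue" "Y \<subseteq> I"
    and XY: "emeasure lebesgue X = emeasure lebesgue Y" "emeasure lebesgue X < \<infinity>"
    and c: "0 < c" and p: "1 \<le> p"
    and f: "\<And>s. s \<in> X \<Longrightarrow> 2 * c < norm (f s)" and g: "\<And>s. norm (g s) = indicator Y s"
    and le: "Lp_norm p I f \<le> ennreal c * Lp_norm p I g"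
  shows "emeasure lebesgue X = 0"
proof (cases "p = \<infinity>")
  case True
  have "esssup (lebesgue_on I) (\<lambda>s. ennreal (norm (g s))) \<le> 1"
  proof (rule esssup_I)
    have "(\<lambda>s. indicator Y s :: ennreal) \<in> borel_measurable lebesgue"
      using Y by measurable
    then show "(\<lambda>s. ennreal (norm (g s))) \<in> borel_measurable (lebesgue_on I)"
      unfolding g ennreal_indicator by (rule measurable_restrict_space1)
  qed (simp add: g indicator_def)
  then have "Lp_norm p I f \<le> ennreal c * 1"
    using True by (intro order.trans[OF le] mult_left_mono) (auto simp: Lp_norm_def)
  then have ef: "esssup (lebesgue_on I) (\<lambda>s. ennreal (norm (f s))) \<le> ennreal c"
    using True by (simp add: Lp_norm_def)
  have "AE s in lebesgue. s \<in> I \<longrightarrow> ennreal (norm (f s)) \<le> esssup (lebesgue_on I) (\<lambda>s. ennreal (norm (f s)))"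
    using esssup_AE[of "\<lambda>s. ennreal (norm (f s))" "lebesgue_on I"] I by (simp add: AE_lebesgue_on_iff)
  then have "AE s in lebesgue. s \<notin> X"
  proof eventually_elim
    case (elim s)
    show ?case
    proof
      assume s: "s \<in> X"
      then have "ennreal (norm (f s)) \<le> ennreal c" using elim X ef by (auto intro: order.trans)
      then show False using f[OF s] c by simp
    qed
  qed
  then show ?thesis
    using X(1) by (simp add: AE_iff_null_sets null_setsD1)
next
  case False
  define q where "q = enn2real p"
  have q: "1 \<le> q"
    using p False enn2real_mono[of 1 p] by (simp add: q_def less_top)
  define m where "m = measure lebesgue X"
  have m: "emeasure lebesgue X = ennreal m" "emeasure lebesgue Y = ennreal m" "0 \<le> m"
    using XY by (auto simp: m_def emeasure_eq_ennreal_measure simp flip: XY(1))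
  have "(\<integral>\<^sup>+ s. ennreal (norm (g s) powr q) \<partial>lebesgue_on I) = (\<integral>\<^sup>+ s. indicator Y s \<partial>lebesgue)"
    using I Y(2) by (subst nn_integral_restrict_space) (auto intro!: nn_integral_cong simp: g indicator_def)
  also have "\<dots> = ennreal m" using Y(1) m by simp
  finally have G: "Lp_norm p I g = ennreal (m powr (1 / q))"
    using False m by (simp add: Lp_norm_def q_def[symmetric] ennroot_def)
  have "ennreal ((2 * c) powr q) * ennreal m = (\<integral>\<^sup>+ s. ennreal ((2 * c) powr q) * indicator X s \<partial>lebesgue)"
    using X(1) m by (simp add: nn_integral_cmult_indicator)
  also have "\<dots> \<le> (\<integral>\<^sup>+ s. ennreal (norm (f s) powr q) * indicator I s \<partial>lebesgue)"
  proof (rule nn_integral_mono)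
    fix s
    show "ennreal ((2 * c) powr q) * indicator X s \<le> ennreal (norm (f s) powr q) * indicator I s"
      using X(2) f[of s] c q by (auto simp: indicator_def intro!: ennreal_leI powr_mono2)
  qed
  also have "\<dots> = (\<integral>\<^sup>+ s. ennreal (norm (f s) powr q) \<partial>lebesgue_on I)"
    using I by (subst nn_integral_restrict_space) auto
  finally have "ennroot q (ennreal ((2 * c) powr q) * ennreal m) \<le> Lp_norm p I f"
    using False q by (auto simp: Lp_norm_def q_def[symmetric] intro!: ennroot_mono)
  then have "ennreal (2 * c) * ennreal (m powr (1 / q)) \<le> ennreal c * ennreal (m powr (1 / q))"
    using le G ennroot_mult[of q "2 * c" "ennreal m"] q c m(3) by (auto simp: ennroot_def)
  then have "2 * c * (m powr (1 / q)) \<le> c * (m powr (1 / q))"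
    using c by (simp flip: ennreal_mult)
  then have "c * (m powr (1 / q)) \<le> 0" by simp
  then have "m = 0"
    using c by (simp add: mult_le_0_iff)
  then show ?thesis using m by simp
qed

section \<open>Measurability and local bounds\<close>

lemma measurable_matrix_vector [measurable (raw)]:
  fixes f :: "'a \<Rightarrow> complex^'m^'k"
  assumes "f \<in> borel_measurable M" "g \<in> borel_measurable M"
  shows "(\<lambda>x. f x *v g x) \<in> borel_measurable M"
  using assms
  by (rule borel_measurable_continuous_Pair)
     (intro bounded_bilinear.continuous_on[OF bounded_bilinear_matrix_vector] continuous_intros)

lemma measurable_matrix_mult [measurable (raw)]:
  fixes f :: "'a \<Rightarrow> complex^'m^'k" and g :: "'a \<Rightarrow> complex^'l^'m"
  assumes "f \<in> borel_measurable M" "g \<in> borel_measurable M"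
  shows "(\<lambda>x. f x ** g x) \<in> borel_measurable M"
  using assms
  by (rule borel_measurable_continuous_Pair)
     (intro bounded_bilinear.continuous_on[OF bounded_bilinear_matrix_mult] continuous_intros)

lemma measurable_vec_component:
  fixes f :: "'a \<Rightarrow> ('b::euclidean_space)^'n"
  assumes "f \<in> borel_measurable M"
  shows "(\<lambda>x. f x $ j) \<in> borel_measurable M"
proof -
  have "(\<lambda>y::'b^'n. y $ j) \<in> borel_measurable borel"
    by (intro borel_measurable_continuous_onI continuous_on_component continuous_on_id)
  from measurable_compose[OF assms this] show ?thesis .
qed

text \<open>Follows the recursion of \<open>Xi\<close> by decreasing coordinate sum. The step may
  use every predecessor, even one with a negative coordinate, which the case \<open>outside\<close>
  provides.\<close>

lemma Nvec_induct [case_names outside zero step]: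
  assumes "\<And>n. n \<notin> Nvec \<Longrightarrow> P n" and "P 0"
    and "\<And>n. n \<in> Nvec \<Longrightarrow> n \<noteq> 0 \<Longrightarrow> (\<And>k. P (n - axis k 1)) \<Longrightarrow> P n"
  shows "P (n :: int^'n)"
proof (induction "nat (\<Sum>i\<in>UNIV. n $ i)" arbitrary: n rule: less_induct)
  case less
  show ?case
  proof (cases "n \<in> Nvec \<and> n \<noteq> 0")
    case True
    then obtain i where "n $ i \<noteq> 0" by (auto simp: vec_eq_iff)
    then have pos: "0 < (\<Sum>i\<in>UNIV. n $ i)"
      using True by (intro sum_pos2[of _ i]) (auto simp: order_less_le Nvec_def)
    have "(\<Sum>i\<in>UNIV. (n - axis k 1) $ i) = (\<Sum>i\<in>UNIV. n $ i) - 1" for k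
      by (simp add: sum_subtractf axis_def)
    then have "P (n - axis k 1)" for k
      using pos by (intro less.hyps) simp
    then show ?thesis using True assms(3) by blast
  qed (use assms(1,2) in auto)
qed

lemma Xi_step:
  "n \<in> Nvec \<Longrightarrow> n \<noteq> 0 \<Longrightarrow>
    Xi L A n t = (\<Sum>k\<in>UNIV. (A t $ k) ** Xi L A (n - axis k 1) (t - L $ k))"
  by (subst Xi.simps) simp

lemma measurable_Xi:
  assumes "A \<in> borel_measurable lebesgue"
  shows "Xi L A n \<in> borel_measurable lebesgue"
proof (induction n rule: Nvec_induct)
  case (step n)
  have "(\<lambda>t. \<Sum>k\<in>UNIV. (A t $ k) ** Xi L A (n - axis k 1) (t - L $ k)) \<in> borel_measurable lebesgue"
    by (intro borel_measurable_sum measurable_matrix_mult measurable_vec_component assms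
        measurable_comp_translate_minus[OF step(3)])
  then show ?case unfolding Xi_step[OF step(1,2), symmetric] .
next
  case (outside n)
  then have "Xi L A n = (\<lambda>t. 0)" by (auto simp: Xi_outside)
  then show ?case by simp
next
  case zero
  have "Xi L A 0 = (\<lambda>t. mat 1)" by (auto simp: Xi_zero)
  then show ?case by simp
qed

lemma measurable_Theta:
  assumes A: "A \<in> borel_measurable lebesgue" and LV: "L \<in> Vplus \<Lambda>"
  shows "Theta L \<Lambda> A n \<in> borel_measurable lebesgue"
proof -
  have m: "(\<lambda>t. if zdot L n - L $ j \<le> t
      then Xi_hat L A (zclass \<Lambda> (n - axis j 1)) t ** (A (t + (L $ j - zdot L n)) $ j) else 0)
     \<in> borel_measurable lebesgue" for j
  proof (rule measurable_If)
    show "{x \<in> space lebesgue. zdot L n - L $ j \<le> x} \<in> sets lebesgue"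
      by (simp flip: atLeast_def)
    show "(\<lambda>t. Xi_hat L A (zclass \<Lambda> (n - axis j 1)) t ** (A (t + (L $ j - zdot L n)) $ j)) \<in> borel_measurable lebesgue"
      unfolding Xi_hat_def
      by (intro borel_measurable_sum measurable_matrix_mult measurable_vec_component
        measurable_comp_translate[OF A] measurable_Xi A)
  qed simp
  have "Theta L \<Lambda> A n = (\<lambda>t. \<Sum>j\<in>UNIV. if zdot L n - L $ j \<le> t
      then Xi_hat L A (zclass \<Lambda> (n - axis j 1)) t ** (A (t + (L $ j - zdot L n)) $ j) else 0)"
    unfolding Theta_eq_sum_indices[OF LV, abs_def] sum.inter_filter[symmetric, OF finite]
    by (simp add: algebra_simps)
  then show ?thesis using m by simp
qed

text \<open>With steps no longer than the shortest delay, the solution up to the next multiple of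
  \<open>\<mu>\<close> is a measurable expression in its truncation at the previous one. At each
  time the truncations are eventually constant.\<close>

lemma measurable_sol:
  assumes L: "L \<in> pos_vec" and A: "A \<in> borel_measurable lebesgue" and v: "v \<in> borel_measurable lebesgue"
  shows "sol L A v \<in> borel_measurable lebesgue"
proof -
  define \<mu> where "\<mu> = delay_min L"
  have \<mu>: "0 < \<mu>" "\<And>j. \<mu> \<le> L $ j" using delay_min_pos[OF L] delay_min_le by (auto simp: \<mu>_def)
  define s where "s k t = (if t < real k * \<mu> then sol L A v t else 0)" for k t
  have s: "s k \<in> borel_measurable lebesgue" for k
  proof (induction k)
    case 0
    have "s 0 = (\<lambda>t. if t < 0 then v t else 0)" by (auto simp: s_def sol_neg)
    moreover have "\<dots> \<in> borel_measurable lebesgue"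
      using v by (intro measurable_If) (simp_all flip: lessThan_def)
    ultimately show ?case by simp
  next
    case (Suc k)
    have "s (Suc k) = (\<lambda>t. if t < real (Suc k) * \<mu> then
        (if t < 0 then v t else (\<Sum>j\<in>UNIV. (A t $ j) *v s k (t - L $ j))) else 0)"
    proof
      fix t
      have "t - L $ j < real k * \<mu>" if "t < real (Suc k) * \<mu>" for j
        using that \<mu>(2)[of j] by (simp add: algebra_simps)
      then show "s (Suc k) t = (if t < real (Suc k) * \<mu> then
        (if t < 0 then v t else (\<Sum>j\<in>UNIV. (A t $ j) *v s k (t - L $ j))) else 0)"
        using sol_nonneg[OF L, of t A v] by (simp add: s_def sol_neg)
    qed
    moreover have "(\<lambda>t. s k (t - L $ j)) \<in> borel_measurable lebesgue" for j
      by (rule measurable_comp_translate_minus[OF Suc])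
    then have "(\<lambda>t. \<Sum>j\<in>UNIV. (A t $ j) *v s k (t - L $ j)) \<in> borel_measurable lebesgue"
      by (intro borel_measurable_sum measurable_matrix_vector measurable_vec_component A)
    then have "(\<lambda>t. if t < real (Suc k) * \<mu> then
        (if t < 0 then v t else (\<Sum>j\<in>UNIV. (A t $ j) *v s k (t - L $ j))) else 0) \<in> borel_measurable lebesgue"
      using v by (intro measurable_If) (simp_all flip: lessThan_def)
    ultimately show ?case by simp
  qed
  show ?thesis
  proof (rule borel_measurable_LIMSEQ_metric)
    show "s k \<in> borel_measurable lebesgue" for k by (rule s)
    show "(\<lambda>k. s k t) \<longlonglongrightarrow> sol L A v t" for t
    proof (rule tendsto_eventually)
      obtain k0 where k0: "t < real k0 * \<mu>" using reals_Archimedean3[OF \<mu>(1)] by blast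
      show "\<forall>\<^sub>F k in sequentially. s k t = sol L A v t"
        using eventually_ge_at_top[of k0]
      proof eventually_elim
        case (elim k)
        have "real k0 * \<mu> \<le> real k * \<mu>" using elim \<mu> by (intro mult_right_mono) auto
        then show ?case using k0 by (simp add: s_def)
      qed
    qed
  qed
qed

section \<open>Bounds uniform over the family of coefficients\<close>

text \<open>Only the bound is uniform; the exceptional null set may depend on \<open>A\<close>,
  since an uncountable union over the family need not be null. The notion is stable under sums,
  products and translations and so passes from the coefficients to \<open>Xi\<close> and
  \<open>Theta\<close>.\<close>

definition locally_bounded_family :: "'a set \<Rightarrow> ('a \<Rightarrow> real \<Rightarrow> 'v::real_normed_vector) \<Rightarrow> bool" where
  "locally_bounded_family \<A> f \<longleftrightarrow>
     (\<forall>a b. \<exists>B. \<forall>A\<in>\<A>. AE t in lebesgue. t \<in> {a..b} \<longrightarrow> norm (f A t) \<le> B)"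

lemma locally_bounded_familyE:
  assumes "locally_bounded_family \<A> f"
  obtains B where "0 \<le> B" "\<And>A. A \<in> \<A> \<Longrightarrow> AE t in lebesgue. t \<in> {a..b} \<longrightarrow> norm (f A t) \<le> B"
proof -
  obtain B where B: "\<And>A. A \<in> \<A> \<Longrightarrow> AE t in lebesgue. t \<in> {a..b} \<longrightarrow> norm (f A t) \<le> B"
    using assms unfolding locally_bounded_family_def by blast
  have "AE t in lebesgue. t \<in> {a..b} \<longrightarrow> norm (f A t) \<le> max 0 B" if "A \<in> \<A>" for A
    using B[OF that] by eventually_elim auto
  then show ?thesis by (rule that[OF max.cobounded1])
qed

lemma locally_bounded_family_cong:
  "(\<And>A t. f A t = g A t) \<Longrightarrow> locally_bounded_family \<A> f = locally_bounded_family \<A> g"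
  by (simp add: locally_bounded_family_def)

lemma locally_bounded_family_const: "locally_bounded_family \<A> (\<lambda>A t. c)"
  unfolding locally_bounded_family_def by (intro allI exI[of _ "norm c"]) simp

lemma locally_bounded_family_add:
  assumes "locally_bounded_family \<A> f" "locally_bounded_family \<A> g"
  shows "locally_bounded_family \<A> (\<lambda>A t. f A t + g A t)"
  unfolding locally_bounded_family_def
proof (intro allI)
  fix a b
  obtain B where B: "0 \<le> B" "\<And>A. A \<in> \<A> \<Longrightarrow> AE t in lebesgue. t \<in> {a..b} \<longrightarrow> norm (f A t) \<le> B"
    using locally_bounded_familyE[OF assms(1)] by blast
  obtain D where D: "0 \<le> D" "\<And>A. A \<in> \<A> \<Longrightarrow> AE t in lebesgue. t \<in> {a..b} \<longrightarrow> norm (g A t) \<le> D"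
    using locally_bounded_familyE[OF assms(2)] by blast
  have "AE t in lebesgue. t \<in> {a..b} \<longrightarrow> norm (f A t + g A t) \<le> B + D" if "A \<in> \<A>" for A
    using B(2)[OF that] D(2)[OF that] by eventually_elim (auto intro: norm_triangle_mono)
  then show "\<exists>B. \<forall>A\<in>\<A>. AE t in lebesgue. t \<in> {a..b} \<longrightarrow> norm (f A t + g A t) \<le> B"
    by blast
qed

lemma locally_bounded_family_sum:
  assumes "\<And>i. i \<in> I \<Longrightarrow> locally_bounded_family \<A> (f i)"
  shows "locally_bounded_family \<A> (\<lambda>A t. \<Sum>i\<in>I. f i A t)"
  using assms
  by (induction I rule: infinite_finite_induct)
     (auto intro: locally_bounded_family_add locally_bounded_family_const)

lemma locally_bounded_family_matrix_mult:
  fixes f :: "'a \<Rightarrow> real \<Rightarrow> complex^'m^'k" and g :: "'a \<Rightarrow> real \<Rightarrow> complex^'l^'m"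
  assumes "locally_bounded_family \<A> f" "locally_bounded_family \<A> g"
  shows "locally_bounded_family \<A> (\<lambda>A t. f A t ** g A t)"
  unfolding locally_bounded_family_def
proof (intro allI)
  fix a b
  obtain C where C: "0 < C" "\<And>(M::complex^'m^'k) (P::complex^'l^'m). norm (M ** P) \<le> norm M * norm P * C"
    using bounded_bilinear.pos_bounded[OF bounded_bilinear_matrix_mult] by blast
  obtain B where B: "0 \<le> B" "\<And>A. A \<in> \<A> \<Longrightarrow> AE t in lebesgue. t \<in> {a..b} \<longrightarrow> norm (f A t) \<le> B"
    using locally_bounded_familyE[OF assms(1)] by blast
  obtain D where D: "0 \<le> D" "\<And>A. A \<in> \<A> \<Longrightarrow> AE t in lebesgue. t \<in> {a..b} \<longrightarrow> norm (g A t) \<le> D"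
    using locally_bounded_familyE[OF assms(2)] by blast
  have "AE t in lebesgue. t \<in> {a..b} \<longrightarrow> norm (f A t ** g A t) \<le> B * D * C" if "A \<in> \<A>" for A
    using B(2)[OF that] D(2)[OF that]
  proof eventually_elim
    case (elim t)
    then show ?case using B(1) C(1) D(1) by (auto intro!: order.trans[OF C(2)] mult_mono)
  qed
  then show "\<exists>B. \<forall>A\<in>\<A>. AE t in lebesgue. t \<in> {a..b} \<longrightarrow> norm (f A t ** g A t) \<le> B"
    by blast
qed

lemma locally_bounded_family_translate:
  assumes "locally_bounded_family \<A> f"
  shows "locally_bounded_family \<A> (\<lambda>A t. f A (t + c))"
  unfolding locally_bounded_family_def
proof (intro allI)
  fix a b
  obtain B where B: "\<And>A. A \<in> \<A> \<Longrightarrow> AE t in lebesgue. t \<in> {a + c..b + c} \<longrightarrow> norm (f A t) \<le> B"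
    using locally_bounded_familyE[OF assms] by blast
  have "AE t in lebesgue. t \<in> {a..b} \<longrightarrow> norm (f A (t + c)) \<le> B" if "A \<in> \<A>" for A
    using AE_lebesgue_translate[OF B[OF that], of c] by eventually_elim auto
  then show "\<exists>B. \<forall>A\<in>\<A>. AE t in lebesgue. t \<in> {a..b} \<longrightarrow> norm (f A (t + c)) \<le> B"
    by blast
qed

lemma locally_bounded_family_if:
  assumes "locally_bounded_family \<A> f"
  shows "locally_bounded_family \<A> (\<lambda>A t. if P t then f A t else 0)"
  unfolding locally_bounded_family_def
proof (intro allI)
  fix a b
  obtain B where B: "0 \<le> B" "\<And>A. A \<in> \<A> \<Longrightarrow> AE t in lebesgue. t \<in> {a..b} \<longrightarrow> norm (f A t) \<le> B"
    using locally_bounded_familyE[OF assms] by blast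
  have "AE t in lebesgue. t \<in> {a..b} \<longrightarrow> norm (if P t then f A t else 0) \<le> B" if "A \<in> \<A>" for A
    using B(2)[OF that] by eventually_elim (use B(1) in auto)
  then show "\<exists>B. \<forall>A\<in>\<A>. AE t in lebesgue. t \<in> {a..b} \<longrightarrow> norm (if P t then f A t else 0) \<le> B"
    by blast
qed

lemma locally_bounded_family_component:
  fixes \<A> :: "(real \<Rightarrow> complex^'d^'d^'n) set"
  assumes \<nu>: "matrix_norm \<nu>" and bd: "uniformly_locally_bounded \<nu> \<A>"
  shows "locally_bounded_family \<A> (\<lambda>A t. A t $ j)"
  unfolding locally_bounded_family_def
proof (intro allI)
  fix a b :: real
  obtain C where C: "0 < C" "\<And>M. norm M \<le> C * \<nu> M"
    using matrix_norm_equivalent[OF \<nu>] by blast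
  have "(SUP A\<in>\<A>. Linf_norm \<nu> {a..b} A) < \<infinity>"
    using bd by (simp add: uniformly_locally_bounded_def)
  then obtain r where r: "(SUP A\<in>\<A>. Linf_norm \<nu> {a..b} A) = ennreal r" "0 \<le> r"
    by (cases "SUP A\<in>\<A>. Linf_norm \<nu> {a..b} A") auto
  have "AE t in lebesgue. t \<in> {a..b} \<longrightarrow> norm (A t $ j) \<le> C * r" if "A \<in> \<A>" for A
  proof -
    have le: "Linf_norm \<nu> {a..b} A \<le> ennreal r"
      unfolding r(1)[symmetric] using that by (rule SUP_upper)
    have "AE t in lebesgue. t \<in> {a..b} \<longrightarrow> ennreal (MAX j. \<nu> (A t $ j)) \<le> Linf_norm \<nu> {a..b} A"
      using esssup_AE[of "\<lambda>t. ennreal (MAX j. \<nu> (A t $ j))" "lebesgue_on {a..b}"]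
      by (simp add: Linf_norm_def AE_lebesgue_on_iff)
    then show ?thesis
    proof eventually_elim
      case (elim t)
      show ?case
      proof
        assume "t \<in> {a..b}"
        with elim le have "ennreal (MAX j. \<nu> (A t $ j)) \<le> ennreal r" by (meson order.trans)
        then have "(MAX j. \<nu> (A t $ j)) \<le> r" using r(2) by (simp add: ennreal_le_iff)
        moreover have "\<nu> (A t $ j) \<le> (MAX j. \<nu> (A t $ j))" by (rule Max_ge) auto
        ultimately have "C * \<nu> (A t $ j) \<le> C * r" using C by (intro mult_left_mono) auto
        then show "norm (A t $ j) \<le> C * r" using C(2) by (meson order.trans)
      qed
    qed
  qed
  then show "\<exists>B. \<forall>A\<in>\<A>. AE t in lebesgue. t \<in> {a..b} \<longrightarrow> norm (A t $ j) \<le> B"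
    by blast
qed

lemma locally_bounded_family_Xi:
  fixes \<A> :: "(real \<Rightarrow> complex^'d^'d^'n) set"
  assumes "matrix_norm \<nu>" "uniformly_locally_bounded \<nu> \<A>"
  shows "locally_bounded_family \<A> (\<lambda>A. Xi L A n)"
proof (induction n rule: Nvec_induct)
  case (step n)
  have "locally_bounded_family \<A> (\<lambda>A t. \<Sum>k\<in>UNIV. (A t $ k) ** Xi L A (n - axis k 1) (t + (- (L $ k))))"
    by (intro locally_bounded_family_sum locally_bounded_family_matrix_mult
        locally_bounded_family_component[OF assms]
        locally_bounded_family_translate[where f = "\<lambda>A. Xi L A (n - axis _ 1)"] step)
  then show ?case
    by (rule locally_bounded_family_cong[THEN iffD1, rotated]) (simp add: Xi_step[OF step(1,2)])
next
  case (outside n)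
  show ?case
    by (rule locally_bounded_family_cong[THEN iffD1, OF _ locally_bounded_family_const[of _ 0]])
       (simp add: Xi_outside[OF outside])
next
  case zero
  show ?case
    by (rule locally_bounded_family_cong[THEN iffD1, OF _ locally_bounded_family_const[of _ "mat 1"]])
       (simp add: Xi_zero)
qed

lemma locally_bounded_family_Theta:
  fixes \<A> :: "(real \<Rightarrow> complex^'d^'d^'n) set"
  assumes "matrix_norm \<nu>" "uniformly_locally_bounded \<nu> \<A>" and LV: "L \<in> Vplus \<Lambda>"
  shows "locally_bounded_family \<A> (\<lambda>A. Theta L \<Lambda> A n)"
proof -
  have "locally_bounded_family \<A> (\<lambda>A t. \<Sum>j\<in>UNIV. if zdot L n - L $ j \<le> t
      then Xi_hat L A (zclass \<Lambda> (n - axis j 1)) t ** (A (t + (L $ j - zdot L n)) $ j) else 0)"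
    unfolding Xi_hat_def
    by (intro locally_bounded_family_sum locally_bounded_family_if locally_bounded_family_matrix_mult
        locally_bounded_family_Xi[OF assms(1,2)]
        locally_bounded_family_translate[OF locally_bounded_family_component[OF assms(1,2)]])
  moreover have "Theta L \<Lambda> A n = (\<lambda>t. \<Sum>j\<in>UNIV. if zdot L n - L $ j \<le> t
      then Xi_hat L A (zclass \<Lambda> (n - axis j 1)) t ** (A (t + (L $ j - zdot L n)) $ j) else 0)" for A :: "real \<Rightarrow> complex^'d^'d^'n"
    unfolding Theta_eq_sum_indices[OF LV, abs_def] sum.inter_filter[symmetric, OF finite]
    by (simp add: algebra_simps)
  ultimately show ?thesis by simp
qed

lemma Theta_bounded_on_sublevel:
  fixes \<A> :: "(real \<Rightarrow> complex^'d^'d^'n) set"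
  assumes "matrix_norm \<nu>" "uniformly_locally_bounded \<nu> \<A>" and LV: "L \<in> Vplus \<Lambda>"
  obtains B where "0 \<le> B"
    "\<And>A n. A \<in> \<A> \<Longrightarrow> n \<in> sublevel L T \<Longrightarrow> AE t in lebesgue. t \<in> {a..b} \<longrightarrow> norm (Theta L \<Lambda> A n t) \<le> B"
proof -
  have "\<exists>B\<ge>0. \<forall>A\<in>\<A>. AE t in lebesgue. t \<in> {a..b} \<longrightarrow> norm (Theta L \<Lambda> A n t) \<le> B" for n
    using locally_bounded_familyE[OF locally_bounded_family_Theta[OF assms, of n], of a b] by metis
  then obtain B where B: "\<And>n. 0 \<le> B n"
      "\<And>n A. A \<in> \<A> \<Longrightarrow> AE t in lebesgue. t \<in> {a..b} \<longrightarrow> norm (Theta L \<Lambda> A n t) \<le> B n"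
    by metis
  have fin: "finite (sublevel L T)" using LV by (intro finite_sublevel) (simp add: Vplus_def)
  have "AE t in lebesgue. t \<in> {a..b} \<longrightarrow> norm (Theta L \<Lambda> A n t) \<le> (\<Sum>n\<in>sublevel L T. B n)"
    if "A \<in> \<A>" "n \<in> sublevel L T" for A n
  proof -
    have "B n \<le> (\<Sum>n\<in>sublevel L T. B n)" using that fin B(1) by (intro member_le_sum) auto
    then show ?thesis using B(2)[OF that(1), of n] by (auto elim!: eventually_mono)
  qed
  then show ?thesis using B(1) by (intro that[of "\<Sum>n\<in>sublevel L T. B n"]) (auto intro: sum_nonneg)
qed

section \<open>Comparison of solutions with Theta\<close>

text \<open>Initial values are prescribed on the half-open interval while norms use the closed one;
  the difference is a null set. Vanishing elsewhere makes the datum a measurable function on the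
  line, ready for translation.\<close>

definition restrict_initial :: "real^'n \<Rightarrow> (real \<Rightarrow> complex^'d) \<Rightarrow> real \<Rightarrow> complex^'d" where
  "restrict_initial L u\<^sub>0 s = (if s \<in> {- Lmax L..<0} then u\<^sub>0 s else 0)"

lemma AE_lebesgue_neq: "AE s in lebesgue. s \<noteq> (c::real)"
  using AE_completion[OF AE_lborel_singleton[of c]] .

lemma AE_restrict_initial:
  "AE s in lebesgue. s \<in> {- Lmax L..0} \<longrightarrow> u\<^sub>0 s = restrict_initial L u\<^sub>0 s"
  using AE_lebesgue_neq[of 0] by eventually_elim (auto simp: restrict_initial_def)

lemma measurable_restrict_initial:
  assumes "u\<^sub>0 \<in> Xp L p"
  shows "restrict_initial L u\<^sub>0 \<in> borel_measurable lebesgue"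
proof -
  have m: "u\<^sub>0 \<in> borel_measurable (lebesgue_on {- Lmax L..0})" using assms by (simp add: Xp_def)
  have "(\<lambda>s. if s \<in> {- Lmax L..0} then u\<^sub>0 s else 0) \<in> borel_measurable lebesgue"
    using m by (simp add: borel_measurable_if del: atLeastAtMost_iff)
  moreover have "AE s in lebesgue. (if s \<in> {- Lmax L..0} then u\<^sub>0 s else 0) = restrict_initial L u\<^sub>0 s"
    using AE_lebesgue_neq[of 0] by eventually_elim (auto simp: restrict_initial_def)
  ultimately show ?thesis by (rule borel_measurable_AE)
qed

lemma Lp_norm_restrict_initial:
  assumes "u\<^sub>0 \<in> Xp L p"
  shows "Lp_norm q {- Lmax L..0} (restrict_initial L u\<^sub>0) = Lp_norm q {- Lmax L..0} u\<^sub>0"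
  using assms by (intro Lp_norm_cong(2)[symmetric] AE_restrict_initial) (auto simp: Xp_def)

lemma is_solution_sol:
  assumes "L \<in> pos_vec" "\<And>s. s \<in> {- Lmax L..<0} \<Longrightarrow> v s = u\<^sub>0 s"
  shows "is_solution L A u\<^sub>0 (sol L A v)"
  unfolding is_solution_def using assms sol_nonneg[OF assms(1), of _ A v] by (auto simp: sol_neg)

text \<open>Unrolling the equation at \<open>t\<close> uses it at the times
  \<open>t - zdot L n\<close>. Once \<open>t\<close> avoids the corresponding translates of one null
  set, the two functions agree at \<open>t\<close> by the induction on which \<open>sol\<close> is
  built.\<close>

lemma is_solution_AE_eq_sol:
  fixes L :: "real^'n"
  assumes L: "L \<in> pos_vec" and u: "is_solution L A u\<^sub>0 u"
  shows "AE t in lebesgue. - Lmax L \<le> t \<longrightarrow> u t = sol L A (restrict_initial L u\<^sub>0) t"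
proof -
  define good where "good t \<longleftrightarrow> (0 \<le> t \<longrightarrow> u t = (\<Sum>j\<in>UNIV. (A t $ j) *v u (t - L $ j)))
     \<and> (t \<in> {- Lmax L..<0} \<longrightarrow> u t = u\<^sub>0 t)" for t
  have good: "AE t in lebesgue. good t"
    using u unfolding is_solution_def good_def by (auto intro: AE_conjI)
  have "AE t in lebesgue. \<forall>n\<in>(Nvec :: (int^'n) set). good (t - zdot L n)"
    by (subst AE_ball_countable) (auto intro: AE_lebesgue_translate_minus[OF good])
  then show ?thesis
  proof (rule eventually_mono)
    fix t assume "\<forall>n\<in>(Nvec :: (int^'n) set). good (t - zdot L n)"
    then show "- Lmax L \<le> t \<longrightarrow> u t = sol L A (restrict_initial L u\<^sub>0) t"
    proof (induction "nat (\<lfloor>t / delay_min L\<rfloor> + 1)" arbitrary: t rule: less_induct)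
      case less
      have g: "good t" using bspec[OF less.prems zero_in_Nvec] by simp
      show ?case
      proof (cases "0 \<le> t")
        case True
        have "u (t - L $ j) = sol L A (restrict_initial L u\<^sub>0) (t - L $ j)" for j
        proof -
          have "(t - L $ j) / delay_min L \<le> t / delay_min L - 1"
            using delay_min_pos[OF L] delay_min_le[of L j] by (simp add: field_simps)
          then have "\<lfloor>(t - L $ j) / delay_min L\<rfloor> \<le> \<lfloor>t / delay_min L - 1\<rfloor>"
            by (rule floor_mono)
          moreover have "0 \<le> \<lfloor>t / delay_min L\<rfloor>"
            using True delay_min_pos[OF L] by simp
          ultimately have "nat (\<lfloor>(t - L $ j) / delay_min L\<rfloor> + 1) < nat (\<lfloor>t / delay_min L\<rfloor> + 1)"
            by simp
          moreover have "\<forall>n\<in>(Nvec :: (int^'n) set). good (t - L $ j - zdot L n)"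
          proof
            fix n :: "int^'n" assume "n \<in> Nvec"
            then have "good (t - zdot L (n + axis j 1))" using less.prems by simp
            then show "good (t - L $ j - zdot L n)" by (simp add: zdot_add algebra_simps)
          qed
          moreover have "- Lmax L \<le> t - L $ j" using True le_Lmax[of L j] by simp
          ultimately show ?thesis using less.hyps by blast
        qed
        then show ?thesis using g True sol_nonneg[OF L True, of A] by (simp add: good_def)
      next
        case False
        then show ?thesis using g by (auto simp: good_def sol_neg restrict_initial_def)
      qed
    qed
  qed
qed

lemma solution_segment:
  assumes L: "L \<in> pos_vec" and A: "A \<in> borel_measurable lebesgue" and u\<^sub>0: "u\<^sub>0 \<in> Xp L p"
    and u: "is_solution L A u\<^sub>0 u" and t: "0 \<le> t"
  shows "(\<lambda>s. u (s + t)) \<in> borel_measurable (lebesgue_on {- Lmax L..0})"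
    and "seg_norm L q u t = seg_norm L q (sol L A (restrict_initial L u\<^sub>0)) t"
proof -
  define w where "w = sol L A (restrict_initial L u\<^sub>0)"
  have w: "w \<in> borel_measurable lebesgue"
    unfolding w_def by (intro measurable_sol L A measurable_restrict_initial[OF u\<^sub>0])
  have m: "(\<lambda>s. w (s + t)) \<in> borel_measurable (lebesgue_on {- Lmax L..0})"
    by (rule measurable_restrict_space1[OF measurable_comp_translate[OF w]])
  have "AE s in lebesgue. - Lmax L \<le> s + t \<longrightarrow> u (s + t) = w (s + t)"
    using AE_lebesgue_translate[OF is_solution_AE_eq_sol[OF L u]] by (simp add: w_def)
  then have ae: "AE s in lebesgue. s \<in> {- Lmax L..0} \<longrightarrow> w (s + t) = u (s + t)"
    by eventually_elim (use t in auto)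
  show "(\<lambda>s. u (s + t)) \<in> borel_measurable (lebesgue_on {- Lmax L..0})"
    using Lp_norm_cong(1)[OF _ m ae] by simp
  show "seg_norm L q u t = seg_norm L q (sol L A (restrict_initial L u\<^sub>0)) t"
    using Lp_norm_cong(2)[OF _ m ae] by (simp add: seg_norm_def w_def)
qed

text \<open>Each class of pairs contributes one \<open>Theta\<close> term, bounded by
  \<open>b\<close> times the datum at its landing point. One representative per class turns the sum
  over classes into part of a sum over lattice points. The generous index set depends on
  \<open>t\<close> alone and so serves the whole window of times \<open>s\<close>.\<close>

lemma norm_sol_le_sum_initial:
  fixes L \<Lambda> :: "real^'n"
  assumes LV: "L \<in> Vplus \<Lambda>" and \<Lambda>: "\<Lambda> \<in> pos_vec"
    and s: "s \<in> {t - Lmax L..t}" and b: "0 \<le> b" "t < Lmax L \<longrightarrow> 1 \<le> b" and t: "0 \<le> t"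
    and Th: "\<And>n x. n \<in> Nvec \<Longrightarrow> s \<in> {zdot L n - Lmax L<..<zdot L n} \<Longrightarrow> 0 \<le> s \<Longrightarrow>
       norm (Theta L \<Lambda> A n s *v x) \<le> b * norm x"
    and ne: "\<And>n. n \<in> (Nvec :: (int^'n) set) \<Longrightarrow> s \<noteq> zdot L n - Lmax L"
  shows "norm (sol L A v s) \<le> b * (\<Sum>n\<in>sublevel L (t + Lmax L). norm (v (s - zdot L n)))"
proof -
  have L: "L \<in> pos_vec" using LV by (simp add: Vplus_def)
  have Lm: "0 < Lmax L" by (rule Lmax_pos[OF L])
  define S where "S = sublevel L (t + Lmax L)"
  have S: "finite S" "0 \<in> S" using finite_sublevel[OF L] t Lm by (auto simp: S_def sublevel_def)
  show ?thesis
  proof (cases "0 \<le> s")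
    case False
    \<comment> \<open>A negative \<open>s\<close> in the window forces \<open>t < Lmax L\<close>.
      There the solution is the datum itself, accounted for by the lattice point 0.\<close>
    then have "1 \<le> b" using s b by auto
    then have "norm (sol L A v s) \<le> b * norm (v (s - zdot L 0))"
      using False mult_right_mono[of 1 b "norm (v s)"] by (simp add: sol_neg)
    also have "\<dots> \<le> b * (\<Sum>n\<in>S. norm (v (s - zdot L n)))"
      using S b by (intro mult_left_mono member_le_sum) auto
    finally show ?thesis by (simp add: S_def)
  next
    case True
    define P where "P = sublevel L s \<times> (UNIV :: 'n set)"
    define h where "h = (\<lambda>(n, j). zdot \<Lambda> n + \<Lambda> $ j)"
    have finP: "finite P" unfolding P_def using finite_sublevel[OF L] by simp
    have "\<forall>y\<in>h ` P. \<exists>m. m \<in> S \<and> zdot \<Lambda> m = y \<and>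
        norm (\<Sum>x\<in>{x \<in> P. h x = y}. sol_term L A v s x) \<le> b * norm (v (s - zdot L m))"
    proof
      fix y assume y: "y \<in> h ` P"
      from y obtain n j where nj: "n \<in> sublevel L s" "y = zdot \<Lambda> n + \<Lambda> $ j"
        by (auto simp: P_def h_def)
      define m where "m = n + axis j 1"
      have m: "m \<in> Nvec" "zdot \<Lambda> m = y" "zdot L m = zdot L n + L $ j"
        using nj by (auto simp: m_def sublevel_def zdot_add)
      have le: "zdot L m \<le> s + Lmax L" using m(3) nj le_Lmax[of L j] by (simp add: sublevel_def)
      have mS: "m \<in> S" using m(1) le s by (simp add: S_def sublevel_def)
      have "norm (\<Sum>x\<in>{x \<in> P. h x = y}. sol_term L A v s x) \<le> b * norm (v (s - zdot L m))"
      proof (cases "s < zdot L m")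
        case lt: True
        have "{x \<in> P. h x = y} = {(n, j). (n, j) \<in> sublevel L s \<times> UNIV \<and> zdot \<Lambda> n + \<Lambda> $ j = zdot \<Lambda> m}"
          by (auto simp: P_def h_def m)
        then have "(\<Sum>x\<in>{x \<in> P. h x = y}. sol_term L A v s x) = Theta L \<Lambda> A m s *v v (s - zdot L m)"
          using sum_sol_term_class[OF LV \<Lambda> lt, of A v] by (simp add: case_prod_beta')
        \<comment> \<open>The inequality \<open>le\<close> is not strict; \<open>ne\<close> excludes
          the remaining end point of the open interval.\<close>
        moreover have "s \<in> {zdot L m - Lmax L<..<zdot L m}" using lt le ne[OF m(1)] by auto
        ultimately show ?thesis using Th[OF m(1) _ True] by simp
      next
        case ge: False
        have "sol_term L A v s x = 0" if x: "x \<in> {x \<in> P. h x = y}" for x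
        proof -
          obtain n' j' where x': "x = (n', j')" by (cases x)
          have "zdot \<Lambda> (n' + axis j' 1) = zdot \<Lambda> m" using x x' m by (simp add: h_def zdot_add)
          from zdot_eq_of_Vplus[OF LV this] show ?thesis
            using ge by (simp add: x' sol_term_def zdot_add)
        qed
        then show ?thesis using b by simp
      qed
      then show "\<exists>m. m \<in> S \<and> zdot \<Lambda> m = y \<and>
          norm (\<Sum>x\<in>{x \<in> P. h x = y}. sol_term L A v s x) \<le> b * norm (v (s - zdot L m))"
        using mS m by blast
    qed
    from bchoice[OF this] obtain m where m: "\<And>y. y \<in> h ` P \<Longrightarrow> m y \<in> S \<and> zdot \<Lambda> (m y) = y \<and>
        norm (\<Sum>x\<in>{x \<in> P. h x = y}. sol_term L A v s x) \<le> b * norm (v (s - zdot L (m y)))"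
      by blast
    \<comment> \<open>The class of \<open>m y\<close> has the value \<open>y\<close>, so distinct
      classes receive distinct representatives.\<close>
    have inj: "inj_on m (h ` P)" by (rule inj_on_inverseI[of _ "zdot \<Lambda>"]) (use m in blast)
    have "sol L A v s = (\<Sum>x\<in>P. sol_term L A v s x)"
      unfolding P_def by (rule sol_representation[OF L True])
    also have "\<dots> = (\<Sum>y\<in>h ` P. \<Sum>x\<in>{x \<in> P. h x = y}. sol_term L A v s x)"
      by (rule sum.image_gen[OF finP])
    finally have "norm (sol L A v s) \<le> (\<Sum>y\<in>h ` P. norm (\<Sum>x\<in>{x \<in> P. h x = y}. sol_term L A v s x))"
      by (simp only: norm_sum)
    also have "\<dots> \<le> (\<Sum>y\<in>h ` P. b * norm (v (s - zdot L (m y))))"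
      using m by (intro sum_mono) blast
    also have "\<dots> = (\<Sum>n\<in>m ` h ` P. b * norm (v (s - zdot L n)))"
      by (subst sum.reindex[OF inj]) simp
    also have "\<dots> \<le> (\<Sum>n\<in>S. b * norm (v (s - zdot L n)))"
      using m b by (intro sum_mono2 S) auto
    finally show ?thesis by (simp add: S_def sum_distrib_left)
  qed
qed

lemma seg_norm_le:
  fixes L \<Lambda> :: "real^'n"
  assumes LV: "L \<in> Vplus \<Lambda>" and \<Lambda>: "\<Lambda> \<in> pos_vec"
    and A: "A \<in> borel_measurable lebesgue" and u\<^sub>0: "u\<^sub>0 \<in> Xp L p"
    and u: "is_solution L A u\<^sub>0 u" and t: "0 \<le> t" and p: "1 \<le> p"
    and b: "0 \<le> b" "t < Lmax L \<longrightarrow> 1 \<le> b"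
    and Th: "\<And>n. n \<in> Nvec \<Longrightarrow> zdot L n \<le> t + Lmax L \<Longrightarrow> AE s in lebesgue. s \<in> {zdot L n - Lmax L<..<zdot L n} \<longrightarrow>
       s \<in> {t - Lmax L..t} \<longrightarrow> 0 \<le> s \<longrightarrow> (\<forall>x. norm (Theta L \<Lambda> A n s *v x) \<le> b * norm x)"
  shows "seg_norm L p u t
     \<le> ennreal (b * (real (card (sublevel L (t + Lmax L))))\<^sup>2) * Lp_norm p {- Lmax L..0} u\<^sub>0"
proof -
  have L: "L \<in> pos_vec" using LV by (simp add: Vplus_def)
  have Lm: "0 < Lmax L" by (rule Lmax_pos[OF L])
  define v where "v = restrict_initial L u\<^sub>0"
  define S where "S = sublevel L (t + Lmax L)"
  have S: "finite S" "S \<noteq> {}" using finite_sublevel[OF L] t Lm by (auto simp: S_def sublevel_def intro!: exI[of _ 0])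
  have v: "v \<in> borel_measurable lebesgue"
    unfolding v_def by (rule measurable_restrict_initial[OF u\<^sub>0])
  \<comment> \<open>Collects, for all \<open>n\<close> at once, the end points and the exceptional
    sets of the coefficient bounds: countably many null sets.\<close>
  have "AE s in lebesgue. \<forall>n\<in>(Nvec :: (int^'n) set). s \<noteq> zdot L n - Lmax L \<and> (s \<in> {zdot L n - Lmax L<..<zdot L n} \<longrightarrow>
       s \<in> {t - Lmax L..t} \<longrightarrow> 0 \<le> s \<longrightarrow> (\<forall>x. norm (Theta L \<Lambda> A n s *v x) \<le> b * norm x))"
  proof (subst AE_ball_countable)
    show "\<forall>n\<in>(Nvec :: (int^'n) set). AE s in lebesgue. s \<noteq> zdot L n - Lmax L \<and> (s \<in> {zdot L n - Lmax L<..<zdot L n} \<longrightarrow>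
       s \<in> {t - Lmax L..t} \<longrightarrow> 0 \<le> s \<longrightarrow> (\<forall>x. norm (Theta L \<Lambda> A n s *v x) \<le> b * norm x))"
    proof
      fix n :: "int^'n" assume n: "n \<in> Nvec"
      show "AE s in lebesgue. s \<noteq> zdot L n - Lmax L \<and> (s \<in> {zdot L n - Lmax L<..<zdot L n} \<longrightarrow>
       s \<in> {t - Lmax L..t} \<longrightarrow> 0 \<le> s \<longrightarrow> (\<forall>x. norm (Theta L \<Lambda> A n s *v x) \<le> b * norm x))"
      proof (rule AE_conjI[OF AE_lebesgue_neq])
        show "AE s in lebesgue. s \<in> {zdot L n - Lmax L<..<zdot L n} \<longrightarrow>
          s \<in> {t - Lmax L..t} \<longrightarrow> 0 \<le> s \<longrightarrow> (\<forall>x. norm (Theta L \<Lambda> A n s *v x) \<le> b * norm x)"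
        proof (cases "zdot L n \<le> t + Lmax L")
          case False
          then show ?thesis by (intro AE_I2) auto
        qed (rule Th[OF n])
      qed
    qed
  qed auto
  then have "AE s in lebesgue. s \<in> {t - Lmax L..t} \<longrightarrow>
      norm (sol L A v s) \<le> b * (\<Sum>n\<in>S. norm (v (s - zdot L n)))"
  proof eventually_elim
    case (elim s)
    show ?case
      unfolding S_def using elim by (intro impI norm_sol_le_sum_initial[OF LV \<Lambda> _ b t]) auto
  qed
  from AE_lebesgue_translate[OF this, of t]
  have ae: "AE s in lebesgue. s \<in> {- Lmax L..0} \<longrightarrow>
      norm (sol L A v (s + t)) \<le> b * (\<Sum>n\<in>S. norm (v (s + (t - zdot L n))))"
    by eventually_elim (auto simp: algebra_simps)
  have "seg_norm L p u t = Lp_norm p {- Lmax L..0} (\<lambda>s. sol L A v (s + t))"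
    using solution_segment(2)[OF L A u\<^sub>0 u t] by (simp add: v_def seg_norm_def)
  also have "\<dots> \<le> ennreal (b * (real (card S))\<^sup>2) * Lp_norm p {- Lmax L..0} v"
  proof (rule Lp_norm_le_sum_translates[OF _ _ _ v _ S b(1) p ae])
    show "(\<lambda>s. sol L A v (s + t)) \<in> borel_measurable (lebesgue_on {- Lmax L..0})"
      by (rule measurable_restrict_space1[OF measurable_comp_translate[OF measurable_sol[OF L A v]]])
    show "v s = 0" if "s \<notin> {- Lmax L..0}" for s using that by (auto simp: v_def restrict_initial_def)
  qed auto
  also have "Lp_norm p {- Lmax L..0} v = Lp_norm p {- Lmax L..0} u\<^sub>0"
    unfolding v_def by (rule Lp_norm_restrict_initial[OF u\<^sub>0])
  finally show ?thesis by (simp add: S_def)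
qed

text \<open>The absolute value of the rate makes one factor valid for growth and for decay.\<close>

lemma exp_le_exp_shift:
  fixes g s t l :: real
  assumes "\<bar>s - t\<bar> \<le> l"
  shows "exp (g * s) \<le> exp (\<bar>g\<bar> * l) * exp (g * t)"
proof -
  have "g * (s - t) \<le> \<bar>g\<bar> * \<bar>s - t\<bar>" by (metis abs_ge_self abs_mult)
  also have "\<dots> \<le> \<bar>g\<bar> * l" using assms by (intro mult_left_mono) auto
  finally show ?thesis by (simp add: algebra_simps flip: exp_add)
qed

lemma exp_typeE:
  assumes "exp_type L \<A> p \<gamma>" "\<gamma> < g"
  obtains K where "0 < K" "\<And>A u\<^sub>0 t u. A \<in> \<A> \<Longrightarrow> u\<^sub>0 \<in> Xp L p \<Longrightarrow> 0 \<le> t \<Longrightarrow> is_solution L A u\<^sub>0 u \<Longrightarrow>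
        seg_norm L p u t \<le> ennreal (K * exp (g * t)) * Lp_norm p {- Lmax L..0} u\<^sub>0"
proof -
  have "0 < g - \<gamma>" "\<gamma> + (g - \<gamma>) = g" using assms(2) by auto
  then have "\<exists>K>0. \<forall>A\<in>\<A>. \<forall>u\<^sub>0\<in>Xp L p. \<forall>t\<ge>0. \<forall>u. is_solution L A u\<^sub>0 u \<longrightarrow>
        seg_norm L p u t \<le> ennreal (K * exp (g * t)) * Lp_norm p {- Lmax L..0} u\<^sub>0"
    using assms(1)[unfolded exp_type_def, THEN spec, of "g - \<gamma>"] by simp
  then obtain K where "0 < K" "\<forall>A\<in>\<A>. \<forall>u\<^sub>0\<in>Xp L p. \<forall>t\<ge>0. \<forall>u. is_solution L A u\<^sub>0 u \<longrightarrow>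
        seg_norm L p u t \<le> ennreal (K * exp (g * t)) * Lp_norm p {- Lmax L..0} u\<^sub>0"
    by (elim exE conjE)
  then show ?thesis by (intro that[of K]) auto
qed

lemma Theta_exp_typeE:
  assumes "Theta_exp_type \<nu> L \<Lambda> \<A> \<gamma>" "\<gamma> < g"
  obtains K where "0 < K" "\<And>A n. A \<in> \<A> \<Longrightarrow> n \<in> Nvec \<Longrightarrow> AE t in lebesgue.
        t \<in> {zdot L n - Lmax L<..<zdot L n} \<longrightarrow> \<nu> (Theta L \<Lambda> A n t) \<le> K * exp (g * t)"
proof -
  have "0 < g - \<gamma>" "\<gamma> + (g - \<gamma>) = g" using assms(2) by auto
  then have "\<exists>K>0. \<forall>A\<in>\<A>. \<forall>n\<in>Nvec. AE t in lebesgue.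
        t \<in> {zdot L n - Lmax L<..<zdot L n} \<longrightarrow> \<nu> (Theta L \<Lambda> A n t) \<le> K * exp (g * t)"
    using assms(1)[unfolded Theta_exp_type_def, THEN spec, of "g - \<gamma>"] by simp
  then obtain K where "0 < K" "\<forall>A\<in>\<A>. \<forall>n\<in>Nvec. AE t in lebesgue.
        t \<in> {zdot L n - Lmax L<..<zdot L n} \<longrightarrow> \<nu> (Theta L \<Lambda> A n t) \<le> K * exp (g * t)"
    by (elim exE conjE)
  then show ?thesis by (intro that[of K]) auto
qed

lemma seg_norm_locally_bounded:
  fixes \<A> :: "(real \<Rightarrow> complex^'d^'d^'n) set"
  assumes \<nu>: "matrix_norm \<nu>" and bd: "uniformly_locally_bounded \<nu> \<A>" and \<A>: "\<A> \<subseteq> Linf_loc \<nu>"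
    and LV: "L \<in> Vplus \<Lambda>" and \<Lambda>: "\<Lambda> \<in> pos_vec" and p: "1 \<le> p"
  obtains C where "0 < C"
    "\<And>A u\<^sub>0 u t. A \<in> \<A> \<Longrightarrow> u\<^sub>0 \<in> Xp L p \<Longrightarrow> is_solution L A u\<^sub>0 u \<Longrightarrow> t \<in> {0..T} \<Longrightarrow>
       seg_norm L p u t \<le> ennreal C * Lp_norm p {- Lmax L..0} u\<^sub>0"
proof -
  have L: "L \<in> pos_vec" using LV by (simp add: Vplus_def)
  obtain D where D: "0 < D" "\<And>(M::complex^'d^'d) (x::complex^'d). norm (M *v x) \<le> norm M * norm x * D"
    using bounded_bilinear.pos_bounded[OF bounded_bilinear_matrix_vector] by blast
  obtain B where B: "0 \<le> B" "\<And>A n. A \<in> \<A> \<Longrightarrow> n \<in> sublevel L (T + Lmax L) \<Longrightarrow>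
      AE t in lebesgue. t \<in> {0..T} \<longrightarrow> norm (Theta L \<Lambda> A n t) \<le> B"
    using Theta_bounded_on_sublevel[OF \<nu> bd LV] by blast
  \<comment> \<open>The 1 serves the negative times of the window, and \<open>D\<close> passes from
    the matrix norm to the action on vectors.\<close>
  define b where "b = max 1 (B * D)"
  define N where "N = real (card (sublevel L (T + Lmax L)))"
  have le: "seg_norm L p u t \<le> ennreal (b * N\<^sup>2 + 1) * Lp_norm p {- Lmax L..0} u\<^sub>0"
    if h: "A \<in> \<A>" "u\<^sub>0 \<in> Xp L p" "is_solution L A u\<^sub>0 u" "t \<in> {0..T}" for A u\<^sub>0 u t
  proof -
    have A: "A \<in> borel_measurable lebesgue" using h \<A> by (auto simp: Linf_loc_def)
    have "seg_norm L p u t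
     \<le> ennreal (b * (real (card (sublevel L (t + Lmax L))))\<^sup>2) * Lp_norm p {- Lmax L..0} u\<^sub>0"
    proof (rule seg_norm_le[OF LV \<Lambda> A h(2,3) _ p])
      fix n :: "int^'n" assume n: "n \<in> Nvec" "zdot L n \<le> t + Lmax L"
      then have "n \<in> sublevel L (T + Lmax L)" using h(4) by (auto simp: sublevel_def)
      from B(2)[OF h(1) this]
      show "AE s in lebesgue. s \<in> {zdot L n - Lmax L<..<zdot L n} \<longrightarrow>
         s \<in> {t - Lmax L..t} \<longrightarrow> 0 \<le> s \<longrightarrow> (\<forall>x. norm (Theta L \<Lambda> A n s *v x) \<le> b * norm x)"
      proof eventually_elim
        case (elim s)
        have "norm (Theta L \<Lambda> A n s *v x) \<le> b * norm x" if "s \<in> {t - Lmax L..t}" "0 \<le> s" for x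
        proof -
          have "norm (Theta L \<Lambda> A n s) \<le> B" using that h(4) elim by auto
          then have "norm (Theta L \<Lambda> A n s) * norm x * D \<le> B * norm x * D"
            using D by (intro mult_right_mono) auto
          also have "\<dots> = B * D * norm x" by simp
          also have "\<dots> \<le> b * norm x" by (intro mult_right_mono) (auto simp: b_def)
          finally show ?thesis using D(2)[of "Theta L \<Lambda> A n s" x] by linarith
        qed
        then show ?case by blast
      qed
    qed (use h in \<open>auto simp: b_def\<close>)
    also have "\<dots> \<le> ennreal (b * N\<^sup>2 + 1) * Lp_norm p {- Lmax L..0} u\<^sub>0"
    proof (intro mult_right_mono ennreal_leI)
      have "card (sublevel L (t + Lmax L)) \<le> card (sublevel L (T + Lmax L))"
        using h(4) by (intro card_mono finite_sublevel[OF L]) (auto simp: sublevel_def)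
      then have "(real (card (sublevel L (t + Lmax L))))\<^sup>2 \<le> N\<^sup>2"
        unfolding N_def by (intro power_mono) auto
      then have "b * (real (card (sublevel L (t + Lmax L))))\<^sup>2 \<le> b * N\<^sup>2"
        by (intro mult_left_mono) (auto simp: b_def)
      then show "b * (real (card (sublevel L (t + Lmax L))))\<^sup>2 \<le> b * N\<^sup>2 + 1" by simp
    qed simp
    finally show ?thesis .
  qed
  \<comment> \<open>The summand 1 keeps the constant positive even if the sublevel set is
    empty.\<close>
  have "0 \<le> b * N\<^sup>2" unfolding b_def by (intro mult_nonneg_nonneg) auto
  then show ?thesis using le by (intro that[of "b * N\<^sup>2 + 1"]) auto
qed

theorem exp_type_of_Theta_exp_type:
  fixes \<A> :: "(real \<Rightarrow> complex^'d^'d^'n) set"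
  assumes \<nu>: "matrix_norm \<nu>" and \<A>: "\<A> \<subseteq> Linf_loc \<nu>"
    and LV: "L \<in> Vplus \<Lambda>" and \<Lambda>: "\<Lambda> \<in> pos_vec" and p: "1 \<le> p"
    and Th: "Theta_exp_type \<nu> L \<Lambda> \<A> \<gamma>"
  shows "exp_type L \<A> p \<gamma>"
  unfolding exp_type_def
proof (intro allI impI)
  fix \<epsilon> :: real assume \<epsilon>: "0 < \<epsilon>"
  have L: "L \<in> pos_vec" using LV by (simp add: Vplus_def)
  have Lm: "0 < Lmax L" by (rule Lmax_pos[OF L])
  \<comment> \<open>Half of \<open>\<epsilon>\<close> is spent on the coefficients, the other half
    on the number of lattice points.\<close>
  define g where "g = \<gamma> + \<epsilon> / 2"
  obtain K1 where K1: "0 < K1" "\<And>A n. A \<in> \<A> \<Longrightarrow> n \<in> Nvec \<Longrightarrow> AE t in lebesgue.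
        t \<in> {zdot L n - Lmax L<..<zdot L n} \<longrightarrow> \<nu> (Theta L \<Lambda> A n t) \<le> K1 * exp (g * t)"
    by (rule Theta_exp_typeE[OF Th, of g]) (use \<epsilon> in \<open>simp_all add: g_def\<close>)
  obtain K2 where K2: "0 < K2" "\<And>t. 0 \<le> t \<Longrightarrow> (real (card (sublevel L (t + Lmax L))))\<^sup>2 \<le> K2 * exp (\<epsilon> / 2 * t)"
    using card_sublevel_subexponential[OF L half_gt_zero[OF \<epsilon>]] by blast
  obtain D where D: "0 < D" "\<And>(M::complex^'d^'d) (x::complex^'d). norm (M *v x) \<le> norm M * norm x * D"
    using bounded_bilinear.pos_bounded[OF bounded_bilinear_matrix_vector] by blast
  obtain C where C: "0 < C" "\<And>M. norm M \<le> C * \<nu> M"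
    using matrix_norm_equivalent[OF \<nu>] by blast
  \<comment> \<open>The exponential compares the times of the window with its right end. The 1
    covers the initial data that are still in the window when \<open>t < Lmax L\<close>.\<close>
  define k where "k = max 1 (C * K1 * D) * exp (\<bar>g\<bar> * Lmax L)"
  have k: "0 < k" by (simp add: k_def)
  have "seg_norm L p u t \<le> ennreal (k * K2 * exp ((\<gamma> + \<epsilon>) * t)) * Lp_norm p {- Lmax L..0} u\<^sub>0"
    if h: "A \<in> \<A>" "u\<^sub>0 \<in> Xp L p" "is_solution L A u\<^sub>0 u" "0 \<le> t" for A u\<^sub>0 u t
  proof -
    have A: "A \<in> borel_measurable lebesgue" using h \<A> by (auto simp: Linf_loc_def)
    define b where "b = k * exp (g * t)"
    have b: "0 \<le> b" using k by (simp add: b_def)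
    have "seg_norm L p u t
     \<le> ennreal (b * (real (card (sublevel L (t + Lmax L))))\<^sup>2) * Lp_norm p {- Lmax L..0} u\<^sub>0"
    proof (rule seg_norm_le[OF LV \<Lambda> A h(2,3,4) p b])
      show "t < Lmax L \<longrightarrow> 1 \<le> b"
      proof
        assume "t < Lmax L"
        then have "exp (g * 0) \<le> exp (\<bar>g\<bar> * Lmax L) * exp (g * t)"
          using h(4) by (intro exp_le_exp_shift) auto
        also have "\<dots> \<le> max 1 (C * K1 * D) * (exp (\<bar>g\<bar> * Lmax L) * exp (g * t))"
          using mult_right_mono[of 1 "max 1 (C * K1 * D)" "exp (\<bar>g\<bar> * Lmax L) * exp (g * t)"] by simp
        finally show "1 \<le> b" by (simp add: b_def k_def mult.assoc)
      qed
    next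
      fix n :: "int^'n" assume n: "n \<in> Nvec"
      from K1(2)[OF h(1) n]
      show "AE s in lebesgue. s \<in> {zdot L n - Lmax L<..<zdot L n} \<longrightarrow>
         s \<in> {t - Lmax L..t} \<longrightarrow> 0 \<le> s \<longrightarrow> (\<forall>x. norm (Theta L \<Lambda> A n s *v x) \<le> b * norm x)"
      proof eventually_elim
        case (elim s)
        have "norm (Theta L \<Lambda> A n s *v x) \<le> b * norm x"
          if s: "s \<in> {zdot L n - Lmax L<..<zdot L n}" "s \<in> {t - Lmax L..t}" for x
        proof -
          have "norm (Theta L \<Lambda> A n s) \<le> C * (K1 * exp (g * s))"
            using elim s(1) C by (auto intro: order.trans[OF C(2)])
          also have "\<dots> \<le> C * (K1 * (exp (\<bar>g\<bar> * Lmax L) * exp (g * t)))"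
            using C K1 s(2) by (intro mult_left_mono exp_le_exp_shift) auto
          finally have "norm (Theta L \<Lambda> A n s) * (norm x * D)
              \<le> C * (K1 * (exp (\<bar>g\<bar> * Lmax L) * exp (g * t))) * (norm x * D)"
            using D by (intro mult_right_mono) auto
          also have "\<dots> = (C * K1 * D) * (exp (\<bar>g\<bar> * Lmax L) * exp (g * t) * norm x)" by simp
          also have "\<dots> \<le> max 1 (C * K1 * D) * (exp (\<bar>g\<bar> * Lmax L) * exp (g * t) * norm x)"
            by (intro mult_right_mono) auto
          also have "\<dots> = b * norm x" by (simp add: b_def k_def)
          finally show ?thesis using D(2)[of "Theta L \<Lambda> A n s" x] by (simp add: mult.assoc)
        qed
        then show ?case by blast
      qed
    qed
    also have "\<dots> \<le> ennreal (k * K2 * exp ((\<gamma> + \<epsilon>) * t)) * Lp_norm p {- Lmax L..0} u\<^sub>0"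
    proof (intro mult_right_mono ennreal_leI)
      have "b * (real (card (sublevel L (t + Lmax L))))\<^sup>2 \<le> b * (K2 * exp (\<epsilon> / 2 * t))"
        using b K2(2)[OF h(4)] by (intro mult_left_mono) auto
      also have "\<dots> = k * K2 * (exp (g * t) * exp (\<epsilon> / 2 * t))" by (simp add: b_def)
      also have "exp (g * t) * exp (\<epsilon> / 2 * t) = exp ((\<gamma> + \<epsilon>) * t)"
        by (simp add: g_def algebra_simps flip: exp_add)
      finally show "b * (real (card (sublevel L (t + Lmax L))))\<^sup>2 \<le> k * K2 * exp ((\<gamma> + \<epsilon>) * t)" .
    qed simp
    finally show ?thesis .
  qed
  then show "\<exists>K>0. \<forall>A\<in>\<A>. \<forall>u\<^sub>0\<in>Xp L p. \<forall>t\<ge>0. \<forall>u. is_solution L A u\<^sub>0 u \<longrightarrow>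
        seg_norm L p u t \<le> ennreal (K * exp ((\<gamma> + \<epsilon>) * t)) * Lp_norm p {- Lmax L..0} u\<^sub>0"
    using k K2(1) by (intro exI[of _ "k * K2"]) auto
qed

section \<open>From solutions back to coefficients\<close>

text \<open>\<open>Wplus\<close> enters here: a pair outside the \<open>\<Lambda>\<close>-class of
  \<open>m\<close> has a different value under \<open>L\<close>, so it lands elsewhere, where
  \<open>v\<close> is assumed to vanish.\<close>

lemma sol_localized:
  assumes LW: "L \<in> Wplus \<Lambda>" and \<Lambda>: "\<Lambda> \<in> pos_vec" and s: "0 \<le> s" "s < zdot L m"
    and loc: "\<And>n j. n \<in> sublevel L s \<Longrightarrow> zdot L n + L $ j \<noteq> zdot L m \<Longrightarrow> v (s - zdot L n - L $ j) = 0"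
  shows "sol L A v s = Theta L \<Lambda> A m s *v v (s - zdot L m)"
proof -
  have LV: "L \<in> Vplus \<Lambda>" using LW Wplus_subset_Vplus by blast
  have L: "L \<in> pos_vec" using LV by (simp add: Vplus_def)
  define Q where "Q = {(n, j). (n, j) \<in> sublevel L s \<times> UNIV \<and> zdot \<Lambda> n + \<Lambda> $ j = zdot \<Lambda> m}"
  have "sol L A v s = (\<Sum>nj\<in>sublevel L s \<times> UNIV. sol_term L A v s nj)"
    by (rule sol_representation[OF L s(1)])
  also have "\<dots> = (\<Sum>nj\<in>Q. sol_term L A v s nj)"
  proof (rule sum.mono_neutral_right)
    show "\<forall>nj\<in>sublevel L s \<times> UNIV - Q. sol_term L A v s nj = 0"
    proof
      fix nj assume nj: "nj \<in> sublevel L s \<times> UNIV - Q"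
      obtain n j where e: "nj = (n, j)" by (cases nj)
      have n: "n \<in> sublevel L s" "zdot \<Lambda> n + \<Lambda> $ j \<noteq> zdot \<Lambda> m" using nj by (auto simp: e Q_def)
      then have "zdot L n + L $ j \<noteq> zdot L m"
        using zdot_eq_of_Wplus[OF LW, of "n + axis j 1" m] by (auto simp: zdot_add)
      with n show "sol_term L A v s nj = 0" by (simp add: e sol_term_def loc)
    qed
  qed (use finite_sublevel[OF L] in \<open>auto simp: Q_def\<close>)
  also have "\<dots> = Theta L \<Lambda> A m s *v v (s - zdot L m)"
    using sum_sol_term_class[OF LV \<Lambda> s(2), of A v] by (simp add: Q_def case_prod_beta')
  finally show ?thesis .
qed

lemma Lp_norm_indicator_finite:
  fixes g :: "real \<Rightarrow> 'b::euclidean_space"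
  assumes I: "I \<in> sets lebesgue" and Y: "Y \<in> sets lebesgue" and fin: "emeasure lebesgue Y < \<infinity>"
    and g: "\<And>s. norm (g s) = indicator Y s"
  shows "Lp_norm p I g < \<infinity>"
proof (cases "p = \<infinity>")
  case True
  have "esssup (lebesgue_on I) (\<lambda>s. ennreal (norm (g s))) \<le> 1"
  proof (rule esssup_I)
    have "(\<lambda>s. indicator Y s :: ennreal) \<in> borel_measurable lebesgue"
      using Y by measurable
    then show "(\<lambda>s. ennreal (norm (g s))) \<in> borel_measurable (lebesgue_on I)"
      unfolding g ennreal_indicator by (rule measurable_restrict_space1)
  qed (simp add: g indicator_def)
  also have "(1::ennreal) < \<infinity>" by simp
  finally show ?thesis using True by (simp add: Lp_norm_def)
next
  case False
  have "(\<integral>\<^sup>+ s. ennreal (norm (g s) powr enn2real p) \<partial>lebesgue_on I) \<le> (\<integral>\<^sup>+ s. indicator Y s \<partial>lebesgue)"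
    using I by (subst nn_integral_restrict_space) (auto intro!: nn_integral_mono simp: g indicator_def)
  also have "\<dots> < \<infinity>" using Y fin by simp
  finally show ?thesis using False by (simp add: Lp_norm_def ennroot_def)
qed

lemma emeasure_lebesgue_translate:
  assumes [measurable]: "E \<in> sets lebesgue"
  shows "{s::real. s + c \<in> E} \<in> sets lebesgue" "emeasure lebesgue {s::real. s + c \<in> E} = emeasure lebesgue E"
proof -
  have "(\<lambda>s. s + c) -` E \<inter> space lebesgue \<in> sets lebesgue"
    by (rule measurable_sets[OF measurable_translate assms])
  moreover have eq: "(\<lambda>s. s + c) -` E \<inter> space lebesgue = {s. s + c \<in> E}" by auto
  ultimately show "{s. s + c \<in> E} \<in> sets lebesgue" by simp
  have "emeasure (distr lebesgue lebesgue (\<lambda>s. s + c)) E = emeasure lebesgue {s. s + c \<in> E}"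
    unfolding eq[symmetric] by (rule emeasure_distr[OF measurable_translate assms])
  then show "emeasure lebesgue {s. s + c \<in> E} = emeasure lebesgue E"
    by (simp add: distr_lebesgue_translate)
qed

text \<open>\<open>\<delta>\<close> has two duties. It is below the distance from
  \<open>zdot L n\<close> to every competing value, so no other class can hit the support of the
  datum. It is also at most \<open>Lmax L\<close>, so the solution window ending at
  \<open>a + \<delta>\<close> contains the whole cell. The bound \<open>2 * c\<close> itself is free
  of \<open>\<delta>\<close>.\<close>

lemma Theta_column_le:
  fixes L :: "real^'n" and A :: "real \<Rightarrow> complex^'d^'d^'n"
  assumes LW: "L \<in> Wplus \<Lambda>" and \<Lambda>: "\<Lambda> \<in> pos_vec" and A: "A \<in> borel_measurable lebesgue"
    and p: "1 \<le> p" and c: "0 < c" and n: "n \<in> Nvec"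
    and \<delta>: "0 < \<delta>" "\<delta> \<le> Lmax L" "0 \<le> a + \<delta>"
    and gap: "\<And>m. m \<in> Nvec \<Longrightarrow> zdot L m \<le> zdot L n + Lmax L \<Longrightarrow> zdot L m \<noteq> zdot L n \<Longrightarrow>
       \<delta> \<le> \<bar>zdot L m - zdot L n\<bar>"
    and bound: "\<And>u\<^sub>0 u. u\<^sub>0 \<in> Xp L p \<Longrightarrow> is_solution L A u\<^sub>0 u \<Longrightarrow>
       seg_norm L p u (a + \<delta>) \<le> ennreal c * Lp_norm p {- Lmax L..0} u\<^sub>0"
  shows "AE s in lebesgue. s \<in> {a..<a + \<delta>} \<longrightarrow> s \<in> {zdot L n - Lmax L<..<zdot L n} \<longrightarrow> 0 \<le> s \<longrightarrow>
       norm (Theta L \<Lambda> A n s *v axis i 1) \<le> 2 * c"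
proof -
  have LV: "L \<in> Vplus \<Lambda>" using LW Wplus_subset_Vplus by blast
  have L: "L \<in> pos_vec" using LV by (simp add: Vplus_def)
  define I where "I = {- Lmax L..0}"
  have I: "I \<in> sets lebesgue" by (simp add: I_def)
  define E where "E = {s \<in> {a..<a + \<delta>} \<inter> {zdot L n - Lmax L<..<zdot L n} \<inter> {0..}.
      2 * c < norm (Theta L \<Lambda> A n s *v axis i 1)}"
  have m: "(\<lambda>s. norm (Theta L \<Lambda> A n s *v axis i 1)) \<in> borel_measurable lebesgue"
    using measurable_Theta[OF A LV, of n] by measurable
  have "{s \<in> space lebesgue. 2 * c < norm (Theta L \<Lambda> A n s *v axis i 1)} \<in> sets lebesgue"
    using m by measurable
  then have "({a..<a + \<delta>} \<inter> {zdot L n - Lmax L<..<zdot L n} \<inter> {0..}) \<inter>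
      {s \<in> space lebesgue. 2 * c < norm (Theta L \<Lambda> A n s *v axis i 1)} \<in> sets lebesgue"
    by (intro sets.Int) auto
  moreover have "E = ({a..<a + \<delta>} \<inter> {zdot L n - Lmax L<..<zdot L n} \<inter> {0..}) \<inter>
      {s \<in> space lebesgue. 2 * c < norm (Theta L \<Lambda> A n s *v axis i 1)}"
    by (auto simp: E_def)
  ultimately have E: "E \<in> sets lebesgue" by (simp only:)
  have Efin: "emeasure lebesgue E < \<infinity>"
  proof -
    have "emeasure lebesgue E \<le> emeasure lebesgue {a..a + \<delta>}"
      by (rule emeasure_mono) (auto simp: E_def)
    also have "\<dots> < \<infinity>" using \<delta> by simp
    finally show ?thesis .
  qed
  \<comment> \<open>\<open>X\<close> is \<open>E\<close> seen in the solution window ending at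
    \<open>a + \<delta>\<close>, \<open>Y\<close> is \<open>E\<close> carried into the initial
    interval by the delay \<open>zdot L n\<close>. The first lies in the interval of the norm
    because \<open>\<delta> \<le> Lmax L\<close>, the second because of the range of
    \<open>s\<close> in \<open>E\<close>.\<close>
  define X where "X = {s. s + (a + \<delta>) \<in> E}"
  define Y where "Y = {s. s + zdot L n \<in> E}"
  note XE = emeasure_lebesgue_translate[OF E, of "a + \<delta>", folded X_def]
  note YE = emeasure_lebesgue_translate[OF E, of "zdot L n", folded Y_def]
  define v :: "real \<Rightarrow> complex^'d" where "v s = (if s \<in> Y then axis i 1 else 0)" for s
  have nv: "norm (v s) = indicator Y s" for s by (simp add: v_def indicator_def)
  have vm: "v \<in> borel_measurable lebesgue"
    unfolding v_def by (rule measurable_If) (use YE(1) in auto)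
  have v: "v \<in> Xp L p"
    unfolding Xp_def using vm Lp_norm_indicator_finite[OF I YE(1) _ nv, of p] YE(2) Efin
    by (auto simp: I_def intro: measurable_restrict_space1)
  have sol: "is_solution L A v (sol L A v)"
    by (rule is_solution_sol[OF L]) simp
  have solE: "sol L A v s = Theta L \<Lambda> A n s *v axis i 1" if s: "s \<in> E" for s
  proof -
    have s': "0 \<le> s" "s < zdot L n" using s by (auto simp: E_def)
    have "v (s - zdot L n' - L $ j) = 0"
      if n': "n' \<in> sublevel L s" and neq: "zdot L n' + L $ j \<noteq> zdot L n" for n' j
    proof (rule ccontr)
      assume "v (s - zdot L n' - L $ j) \<noteq> 0"
      then have in_E: "s - zdot L n' - L $ j + zdot L n \<in> E"
        by (auto simp: v_def Y_def split: if_splits)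
      have e: "zdot L (n' + axis j 1) = zdot L n' + L $ j" by (simp add: zdot_add)
      \<comment> \<open>The point in \<open>in_E\<close> and \<open>s\<close> would be two points of
        \<open>E\<close> at least \<open>\<delta>\<close> apart, while \<open>E\<close> lies in a
        half-open interval of length \<open>\<delta>\<close>.\<close>
      have "\<delta> \<le> \<bar>zdot L (n' + axis j 1) - zdot L n\<bar>"
      proof (rule gap)
        show "n' + axis j 1 \<in> Nvec" using n' by (simp add: sublevel_def)
        show "zdot L (n' + axis j 1) \<le> zdot L n + Lmax L"
          using n' s' le_Lmax[of L j] by (simp add: e sublevel_def)
        show "zdot L (n' + axis j 1) \<noteq> zdot L n" using neq by (simp add: e)
      qed
      then show False using in_E s by (auto simp: e E_def)
    qed
    then have "sol L A v s = Theta L \<Lambda> A n s *v v (s - zdot L n)"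
      by (rule sol_localized[OF LW \<Lambda> s'])
    then show ?thesis using s by (simp add: v_def Y_def)
  qed
  have "emeasure lebesgue X = 0"
  proof (rule null_of_Lp_norm_le[OF I XE(1) _ YE(1) _ _ _ c p _ nv])
    show "X \<subseteq> I" using \<delta> by (auto simp: X_def E_def I_def)
    show "Y \<subseteq> I" by (auto simp: Y_def E_def I_def)
    show "2 * c < norm (sol L A v (s + (a + \<delta>)))" if "s \<in> X" for s
      using that by (auto simp: X_def solE) (simp add: E_def)
    show "Lp_norm p I (\<lambda>s. sol L A v (s + (a + \<delta>))) \<le> ennreal c * Lp_norm p I v"
      using bound[OF v sol] by (simp add: seg_norm_def I_def)
  qed (use XE YE Efin in auto)
  then have "E \<in> null_sets lebesgue" using XE(2) E by (simp add: null_setsI)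
  then have "AE s in lebesgue. s \<notin> E" by (rule AE_not_in)
  then show ?thesis by eventually_elim (auto simp: E_def)
qed

theorem Theta_exp_type_of_exp_type:
  fixes \<A> :: "(real \<Rightarrow> complex^'d^'d^'n) set"
  assumes \<nu>: "matrix_norm \<nu>" and bd: "uniformly_locally_bounded \<nu> \<A>" and \<A>: "\<A> \<subseteq> Linf_loc \<nu>"
    and LW: "L \<in> Wplus \<Lambda>" and \<Lambda>: "\<Lambda> \<in> pos_vec" and p: "1 \<le> p"
    and ex: "exp_type L \<A> p \<gamma>"
  shows "Theta_exp_type \<nu> L \<Lambda> \<A> \<gamma>"
  unfolding Theta_exp_type_def
proof (intro allI impI)
  fix \<epsilon> :: real assume \<epsilon>: "0 < \<epsilon>"
  have LV: "L \<in> Vplus \<Lambda>" using LW Wplus_subset_Vplus by blast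
  have L: "L \<in> pos_vec" using LV by (simp add: Vplus_def)
  have Lm: "0 < Lmax L" by (rule Lmax_pos[OF L])
  define g where "g = \<gamma> + \<epsilon>"
  obtain K where K: "0 < K" "\<And>A u\<^sub>0 t u. A \<in> \<A> \<Longrightarrow> u\<^sub>0 \<in> Xp L p \<Longrightarrow> 0 \<le> t \<Longrightarrow> is_solution L A u\<^sub>0 u \<Longrightarrow>
        seg_norm L p u t \<le> ennreal (K * exp (g * t)) * Lp_norm p {- Lmax L..0} u\<^sub>0"
    by (rule exp_typeE[OF ex, of g]) (use \<epsilon> in \<open>simp_all add: g_def\<close>)
  obtain C where C: "0 < C" "\<And>M. \<nu> M \<le> C * norm M"
    using matrix_norm_equivalent[OF \<nu>] by blast
  obtain B where B: "0 \<le> B" "\<And>A n. A \<in> \<A> \<Longrightarrow> n \<in> sublevel L (Lmax L) \<Longrightarrow>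
      AE t in lebesgue. t \<in> {- Lmax L..0} \<longrightarrow> norm (Theta L \<Lambda> A n t) \<le> B"
    using Theta_bounded_on_sublevel[OF \<nu> bd LV] by blast
  \<comment> \<open>One term per column with the factor 2 of the test argument, plus
    \<open>B\<close> for negative times. The exponential compares a cell with its right end, and
    negative times with 0.\<close>
  define k where "k = (real CARD('d) * (2 * K) + B) * exp (\<bar>g\<bar> * Lmax L)"
  have k: "0 < k" unfolding k_def using K B
    by (intro mult_pos_pos add_pos_nonneg) auto
  have kle: "real CARD('d) * (2 * K) * exp (\<bar>g\<bar> * Lmax L) \<le> k" "B * exp (\<bar>g\<bar> * Lmax L) \<le> k"
    unfolding k_def using K B by (auto intro!: mult_right_mono)
  have main: "AE t in lebesgue. t \<in> {zdot L n - Lmax L<..<zdot L n} \<longrightarrow> norm (Theta L \<Lambda> A n t) \<le> k * exp (g * t)"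
    if A\<A>: "A \<in> \<A>" and n: "n \<in> Nvec" for A n
  proof -
    have A: "A \<in> borel_measurable lebesgue" using A\<A> \<A> by (auto simp: Linf_loc_def)
    \<comment> \<open>Landing points involve only values up to \<open>zdot L n + Lmax L\<close>.
      These are finitely many, so the ones different from \<open>zdot L n\<close> keep a positive
      distance, which depends on \<open>n\<close>.\<close>
    obtain d where d: "0 < d" "\<And>x. x \<in> zdot L ` sublevel L (zdot L n + Lmax L) \<Longrightarrow> x \<noteq> zdot L n \<Longrightarrow> d \<le> dist (zdot L n) x"
      using finite_set_avoid[OF finite_imageI[OF finite_sublevel[OF L]]] by metis
    define \<delta> where "\<delta> = min (Lmax L) d"
    have \<delta>: "0 < \<delta>" "\<delta> \<le> Lmax L" using Lm d by (auto simp: \<delta>_def)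
    have gap: "\<delta> \<le> \<bar>zdot L m - zdot L n\<bar>"
      if "m \<in> Nvec" "zdot L m \<le> zdot L n + Lmax L" "zdot L m \<noteq> zdot L n" for m
      using d(2)[of "zdot L m"] that by (force simp: \<delta>_def dist_real_def sublevel_def)
    \<comment> \<open>Countably many cells of length \<open>\<delta>\<close> cover the line. In
      each, the solution bound is read at the right end, the time whose window contains the cell; a
      cell ending before 0 contains no \<open>s \<ge> 0\<close>.\<close>
    have nonneg: "AE s in lebesgue. \<forall>z::int. \<forall>i. s \<in> {of_int z * \<delta>..<of_int z * \<delta> + \<delta>} \<longrightarrow>
        s \<in> {zdot L n - Lmax L<..<zdot L n} \<longrightarrow> 0 \<le> s \<longrightarrow>
        norm (Theta L \<Lambda> A n s *v axis i 1) \<le> 2 * (K * exp (g * (of_int z * \<delta> + \<delta>)))"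
    proof (subst AE_all_countable, intro allI, subst AE_all_countable, intro allI)
      fix z :: int and i
      show "AE s in lebesgue. s \<in> {of_int z * \<delta>..<of_int z * \<delta> + \<delta>} \<longrightarrow>
        s \<in> {zdot L n - Lmax L<..<zdot L n} \<longrightarrow> 0 \<le> s \<longrightarrow>
        norm (Theta L \<Lambda> A n s *v axis i 1) \<le> 2 * (K * exp (g * (of_int z * \<delta> + \<delta>)))"
      proof (cases "0 \<le> of_int z * \<delta> + \<delta>")
        case True
        show ?thesis
          by (rule Theta_column_le[OF LW \<Lambda> A p _ n \<delta> True]) (use K gap A\<A> True in auto)
      next
        case False
        then show ?thesis by (intro AE_I2) auto
      qed
    qed
    \<comment> \<open>The solution bound says nothing about \<open>Theta\<close> at negative times.
      These occur only when \<open>zdot L n < Lmax L\<close>, hence for finitely many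
      \<open>n\<close>, and local boundedness suffices.\<close>
    have neg: "AE s in lebesgue. s \<in> {zdot L n - Lmax L<..<zdot L n} \<longrightarrow> s < 0 \<longrightarrow> norm (Theta L \<Lambda> A n s) \<le> B"
    proof (cases "zdot L n \<le> Lmax L")
      case True
      then have "n \<in> sublevel L (Lmax L)" using n by (simp add: sublevel_def)
      from B(2)[OF A\<A> this] show ?thesis
        by eventually_elim (use zdot_nonneg[OF L n] in auto)
    next
      case False
      then show ?thesis by (intro AE_I2) auto
    qed
    from nonneg neg show ?thesis
    proof eventually_elim
      case (elim s)
      show ?case
      proof
        assume s: "s \<in> {zdot L n - Lmax L<..<zdot L n}"
        show "norm (Theta L \<Lambda> A n s) \<le> k * exp (g * s)"
        proof (cases "0 \<le> s")
          case True
          define z where "z = \<lfloor>s / \<delta>\<rfloor>"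
          have "of_int z \<le> s / \<delta>" "s / \<delta> < of_int z + 1" by (auto simp: z_def)
          then have z: "s \<in> {of_int z * \<delta>..<of_int z * \<delta> + \<delta>}" using \<delta> by (simp add: field_simps)
          have col: "norm (Theta L \<Lambda> A n s *v axis i 1) \<le> 2 * K * (exp (\<bar>g\<bar> * Lmax L) * exp (g * s))" for i
          proof -
            have "norm (Theta L \<Lambda> A n s *v axis i 1) \<le> 2 * (K * exp (g * (of_int z * \<delta> + \<delta>)))"
              using elim(1) z s True by blast
            also have "\<dots> \<le> 2 * (K * (exp (\<bar>g\<bar> * Lmax L) * exp (g * s)))"
              using K z \<delta> by (intro mult_left_mono exp_le_exp_shift) auto
            finally show ?thesis by (simp add: mult.assoc)
          qed
          have "norm (Theta L \<Lambda> A n s) \<le> (\<Sum>i\<in>UNIV. norm (Theta L \<Lambda> A n s *v axis i 1))"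
            by (rule norm_matrix_le_sum_columns)
          also have "\<dots> \<le> (\<Sum>i\<in>(UNIV::'d set). 2 * K * (exp (\<bar>g\<bar> * Lmax L) * exp (g * s)))"
            by (intro sum_mono col)
          also have "\<dots> = real CARD('d) * (2 * K) * exp (\<bar>g\<bar> * Lmax L) * exp (g * s)" by simp
          also have "\<dots> \<le> k * exp (g * s)" by (intro mult_right_mono kle) simp
          finally show ?thesis .
        next
          case False
          then have "norm (Theta L \<Lambda> A n s) \<le> B * exp (g * 0)" using elim(2) s by simp
          also have "\<dots> \<le> B * (exp (\<bar>g\<bar> * Lmax L) * exp (g * s))"
            using B s False zdot_nonneg[OF L n] by (intro mult_left_mono exp_le_exp_shift) auto
          also have "\<dots> = B * exp (\<bar>g\<bar> * Lmax L) * exp (g * s)" by simp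
          also have "\<dots> \<le> k * exp (g * s)" by (intro mult_right_mono kle) simp
          finally show ?thesis .
        qed
      qed
    qed
  qed
  have "AE t in lebesgue. t \<in> {zdot L n - Lmax L<..<zdot L n} \<longrightarrow> \<nu> (Theta L \<Lambda> A n t) \<le> C * k * exp (g * t)"
    if "A \<in> \<A>" "n \<in> Nvec" for A n
    using main[OF that]
  proof eventually_elim
    case (elim t)
    show ?case
    proof
      assume "t \<in> {zdot L n - Lmax L<..<zdot L n}"
      then have "C * norm (Theta L \<Lambda> A n t) \<le> C * (k * exp (g * t))"
        using elim C by (intro mult_left_mono) auto
      then show "\<nu> (Theta L \<Lambda> A n t) \<le> C * k * exp (g * t)"
        using C(2)[of "Theta L \<Lambda> A n t"] by (simp add: mult.assoc)
    qed
  qed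
  then show "\<exists>K>0. \<forall>A\<in>\<A>. \<forall>n\<in>Nvec. AE t in lebesgue.
        t \<in> {zdot L n - Lmax L<..<zdot L n} \<longrightarrow> \<nu> (Theta L \<Lambda> A n t) \<le> K * exp ((\<gamma> + \<epsilon>) * t)"
    using C(1) k by (intro exI[of _ "C * k"]) (auto simp: g_def)
qed

section \<open>Lyapunov exponents\<close>

text \<open>The conventions at 0 and at infinity are those for which this equivalence has no
  exceptions.\<close>

lemma eln_divide_le_iff:
  assumes "0 < t"
  shows "eln x / ereal t \<le> ereal g \<longleftrightarrow> x \<le> ennreal (exp (g * t))"
proof (cases x)
  case (real r)
  show ?thesis
  proof (cases "r = 0")
    case False
    with real have r: "0 < r" by simp
    have "ln r / t \<le> g \<longleftrightarrow> ln r \<le> g * t" using assms by (simp add: field_simps)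
    also have "\<dots> \<longleftrightarrow> r \<le> exp (g * t)" 
      using r by (metis exp_le_cancel_iff exp_ln)
    finally show ?thesis using real r assms by (simp add: eln_def ennreal_le_iff)
  qed (use real assms in \<open>simp add: eln_def\<close>)
qed (use assms in \<open>simp add: eln_def top_unique\<close>)

lemma eventually_const_exp_le:
  fixes g \<gamma> K :: real
  assumes "g < \<gamma>" "0 < K"
  shows "\<exists>T. \<forall>t\<ge>T. K * exp (g * t) \<le> exp (\<gamma> * t)"
proof (intro exI allI impI)
  fix t assume "ln K / (\<gamma> - g) \<le> t"
  then have "ln K + g * t \<le> \<gamma> * t" using assms by (simp add: field_simps)
  then have "exp (ln K + g * t) \<le> exp (\<gamma> * t)" by simp
  then show "K * exp (g * t) \<le> exp (\<gamma> * t)" using assms by (simp add: exp_add)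
qed

lemma is_solution_scaleR:
  assumes "is_solution L A u\<^sub>0 u"
  shows "is_solution L A (\<lambda>s. c *\<^sub>R u\<^sub>0 s) (\<lambda>s. c *\<^sub>R u s)"
  unfolding is_solution_def
proof (rule conjI)
  have "AE t in lebesgue. 0 \<le> t \<longrightarrow> u t = (\<Sum>j\<in>UNIV. (A t $ j) *v u (t - L $ j))"
    using assms by (simp add: is_solution_def)
  then show "AE t in lebesgue. 0 \<le> t \<longrightarrow> c *\<^sub>R u t = (\<Sum>j\<in>UNIV. (A t $ j) *v (c *\<^sub>R u (t - L $ j)))"
    by eventually_elim
       (simp add: scaleR_sum_right bounded_bilinear.scaleR_right[OF bounded_bilinear_matrix_vector])
  have "AE t in lebesgue. t \<in> {- Lmax L..<0} \<longrightarrow> u t = u\<^sub>0 t"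
    using assms by (simp add: is_solution_def)
  then show "AE t in lebesgue. t \<in> {- Lmax L..<0} \<longrightarrow> c *\<^sub>R u t = c *\<^sub>R u\<^sub>0 t"
    by eventually_elim simp
qed

text \<open>The exponent tests only data of norm one, the exponential type tests all data; linearity
  of the equation bridges the difference.\<close>

lemma max_lyapunov_le_iff:
  fixes \<A> :: "(real \<Rightarrow> complex^'d^'d^'n) set"
  assumes \<nu>: "matrix_norm \<nu>" and bd: "uniformly_locally_bounded \<nu> \<A>" and \<A>: "\<A> \<subseteq> Linf_loc \<nu>"
    and LV: "L \<in> Vplus \<Lambda>" and \<Lambda>: "\<Lambda> \<in> pos_vec" and p: "1 \<le> p"
  shows "max_lyapunov L \<A> p \<le> ereal \<gamma> \<longleftrightarrow> exp_type L \<A> p \<gamma>"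
proof
  have L: "L \<in> pos_vec" using LV by (simp add: Vplus_def)
  define I where "I = {- Lmax L..0}"
  have I: "I \<in> sets lebesgue" by (simp add: I_def)
  define U where "U A = {(u\<^sub>0, u). u\<^sub>0 \<in> Xp L p \<and> Lp_norm p I u\<^sub>0 = 1 \<and> is_solution L A u\<^sub>0 u}"
    for A :: "real \<Rightarrow> complex^'d^'d^'n"
  define \<Phi> where "\<Phi> t = (SUP A\<in>\<A>. SUP (u\<^sub>0, u)\<in>U A. eln (seg_norm L p u t) / ereal t)" for t
  have \<Phi>: "max_lyapunov L \<A> p = Limsup at_top \<Phi>"
    by (simp add: max_lyapunov_def \<Phi>_def[abs_def] U_def I_def)
  {
    assume le: "max_lyapunov L \<A> p \<le> ereal \<gamma>"
    show "exp_type L \<A> p \<gamma>"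
      unfolding exp_type_def
    proof (intro allI impI)
      fix \<epsilon> :: real assume \<epsilon>: "0 < \<epsilon>"
      define g where "g = \<gamma> + \<epsilon>"
      have "ereal \<gamma> < ereal g" using \<epsilon> by (simp add: g_def)
      then have "\<forall>\<^sub>F t in at_top. \<Phi> t < ereal g"
        using le unfolding \<Phi> Limsup_le_iff by blast
      then obtain T0 where T0: "\<And>t. T0 \<le> t \<Longrightarrow> \<Phi> t < ereal g"
        unfolding eventually_at_top_linorder by blast
      \<comment> \<open>The 1 keeps \<open>t\<close> positive beyond \<open>T\<close>, as the
        division by \<open>t\<close> requires.\<close>
      define T where "T = max T0 1"
      obtain C where C: "0 < C" "\<And>A u\<^sub>0 u t. A \<in> \<A> \<Longrightarrow> u\<^sub>0 \<in> Xp L p \<Longrightarrow> is_solution L A u\<^sub>0 u \<Longrightarrow> t \<in> {0..T} \<Longrightarrow>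
         seg_norm L p u t \<le> ennreal C * Lp_norm p I u\<^sub>0"
        using seg_norm_locally_bounded[OF \<nu> bd \<A> LV \<Lambda> p] unfolding I_def by blast
      define K where "K = max 1 (C * exp (\<bar>g\<bar> * T))"
      have "seg_norm L p u t \<le> ennreal (K * exp (g * t)) * Lp_norm p I u\<^sub>0"
        if h: "A \<in> \<A>" "u\<^sub>0 \<in> Xp L p" "is_solution L A u\<^sub>0 u" "0 \<le> t" for A u\<^sub>0 u t
      proof (cases "t \<le> T")
        case True
        have "C * exp (g * 0) \<le> C * (exp (\<bar>g\<bar> * T) * exp (g * t))"
          using C h True by (intro mult_left_mono exp_le_exp_shift) auto
        also have "\<dots> \<le> K * exp (g * t)"
          unfolding mult.assoc[symmetric] by (intro mult_right_mono) (auto simp: K_def)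
        finally have "ennreal C * Lp_norm p I u\<^sub>0 \<le> ennreal (K * exp (g * t)) * Lp_norm p I u\<^sub>0"
          by (intro mult_right_mono ennreal_leI) auto
        then show ?thesis using C(2)[OF h(1-3), of t] h(4) True by (auto intro: order.trans)
      next
        case False
        then have t: "0 < t" "T0 \<le> t" by (auto simp: T_def)
        have A: "A \<in> borel_measurable lebesgue" using h \<A> by (auto simp: Linf_loc_def)
        have u\<^sub>0m: "u\<^sub>0 \<in> borel_measurable (lebesgue_on I)" "Lp_norm p I u\<^sub>0 < \<infinity>"
          using h by (auto simp: Xp_def I_def)
        then obtain r where r: "Lp_norm p I u\<^sub>0 = ennreal r" "0 \<le> r" by (cases "Lp_norm p I u\<^sub>0") auto
        show ?thesis
        proof (cases "r = 0")
          \<comment> \<open>A datum of norm 0 cannot be normalised, but the bound on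
            \<open>{0..t}\<close> forces its solution segment to have norm 0.\<close>
          case True
          obtain C' where "seg_norm L p u t \<le> ennreal C' * Lp_norm p I u\<^sub>0"
            using seg_norm_locally_bounded[OF \<nu> bd \<A> LV \<Lambda> p, of t] h unfolding I_def
            by (metis atLeastAtMost_iff order_refl)
          then show ?thesis using r True by simp
        next
          case False
          with r have rpos: "0 < r" by simp
          define w\<^sub>0 where "w\<^sub>0 s = (1 / r) *\<^sub>R u\<^sub>0 s" for s
          define w where "w s = (1 / r) *\<^sub>R u s" for s
          have w0n: "Lp_norm p I w\<^sub>0 = 1"
            unfolding w\<^sub>0_def using Lp_norm_scaleR[OF I u\<^sub>0m(1) p, of "1 / r"] rpos r
            by (simp flip: ennreal_mult)
          have w0: "w\<^sub>0 \<in> Xp L p"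
            using u\<^sub>0m(1) w0n unfolding Xp_def I_def[symmetric] by (auto simp: w\<^sub>0_def[abs_def])
          have wsol: "is_solution L A w\<^sub>0 w"
            unfolding w_def w\<^sub>0_def by (rule is_solution_scaleR[OF h(3)])
          have seg: "seg_norm L p w t = ennreal (1 / r) * seg_norm L p u t"
            unfolding seg_norm_def w_def I_def[symmetric]
            using solution_segment(1)[OF L A h(2,3,4)] rpos
            by (intro Lp_norm_scaleR[OF I _ p]) (auto simp: I_def)
          have "eln (seg_norm L p w t) / ereal t \<le> (SUP (u\<^sub>0, u)\<in>U A. eln (seg_norm L p u t) / ereal t)"
            using w0 w0n wsol by (intro SUP_upper2[of "(w\<^sub>0, w)"]) (auto simp: U_def)
          also have "\<dots> \<le> \<Phi> t" unfolding \<Phi>_def using h(1) by (rule SUP_upper)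
          also have "\<dots> \<le> ereal g" using T0[OF t(2)] by simp
          finally have "seg_norm L p w t \<le> ennreal (exp (g * t))"
            by (simp add: eln_divide_le_iff[OF t(1)])
          then have "ennreal r * seg_norm L p w t \<le> ennreal r * ennreal (exp (g * t))"
            by (rule mult_left_mono) simp
          moreover have "ennreal r * seg_norm L p w t = seg_norm L p u t"
            unfolding seg using rpos by (simp add: mult.assoc[symmetric] flip: ennreal_mult)
          ultimately have "seg_norm L p u t \<le> ennreal (exp (g * t)) * Lp_norm p I u\<^sub>0"
            by (simp add: r mult.commute)
          also have "\<dots> \<le> ennreal (K * exp (g * t)) * Lp_norm p I u\<^sub>0"
          proof (intro mult_right_mono ennreal_leI)
            show "exp (g * t) \<le> K * exp (g * t)"
              using mult_right_mono[of 1 K "exp (g * t)"] by (simp add: K_def)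
          qed simp
          finally show ?thesis .
        qed
      qed
      moreover have "0 < K" by (simp add: K_def)
      ultimately show "\<exists>K>0. \<forall>A\<in>\<A>. \<forall>u\<^sub>0\<in>Xp L p. \<forall>t\<ge>0. \<forall>u. is_solution L A u\<^sub>0 u \<longrightarrow>
        seg_norm L p u t \<le> ennreal (K * exp ((\<gamma> + \<epsilon>) * t)) * Lp_norm p {- Lmax L..0} u\<^sub>0"
        unfolding g_def I_def by blast
    qed
  }
  {
    assume ex: "exp_type L \<A> p \<gamma>"
    show "max_lyapunov L \<A> p \<le> ereal \<gamma>"
      unfolding \<Phi> Limsup_le_iff
    proof (intro allI impI)
      fix y assume "ereal \<gamma> < y"
      \<comment> \<open>Two rates are inserted below \<open>y\<close>: \<open>g\<close> is supplied
        by the exponential type, and \<open>z\<close> absorbs its constant at large times.\<close>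
      then obtain z where z: "\<gamma> < z" "ereal z < y" using ereal_dense2[of "ereal \<gamma>" y] by auto
      define g where "g = (\<gamma> + z) / 2"
      have g: "\<gamma> < g" "g < z" using z by (auto simp: g_def)
      obtain K where K: "0 < K" "\<And>A u\<^sub>0 t u. A \<in> \<A> \<Longrightarrow> u\<^sub>0 \<in> Xp L p \<Longrightarrow> 0 \<le> t \<Longrightarrow> is_solution L A u\<^sub>0 u \<Longrightarrow>
          seg_norm L p u t \<le> ennreal (K * exp (g * t)) * Lp_norm p I u\<^sub>0"
        unfolding I_def by (rule exp_typeE[OF ex g(1)]) simp_all
      obtain T where T: "\<And>t. T \<le> t \<Longrightarrow> K * exp (g * t) \<le> exp (z * t)"
        using eventually_const_exp_le[OF g(2) K(1)] by blast
      show "\<forall>\<^sub>F t in at_top. \<Phi> t < y"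
        using eventually_ge_at_top[of "max T 1"]
      proof eventually_elim
        case (elim t)
        then have t: "T \<le> t" "0 < t" by auto
        have "\<Phi> t \<le> ereal z"
          unfolding \<Phi>_def
        proof (intro SUP_least, clarify)
          fix A u\<^sub>0 u assume A: "A \<in> \<A>" and "(u\<^sub>0, u) \<in> U A"
          then have u: "u\<^sub>0 \<in> Xp L p" "Lp_norm p I u\<^sub>0 = 1" "is_solution L A u\<^sub>0 u" by (auto simp: U_def)
          have "seg_norm L p u t \<le> ennreal (K * exp (g * t))"
            using K(2)[OF A u(1) _ u(3), of t] t by (simp add: u)
          also have "\<dots> \<le> ennreal (exp (z * t))" using T[OF t(1)] by (rule ennreal_leI)
          finally show "eln (seg_norm L p u t) / ereal t \<le> ereal z"
            by (simp add: eln_divide_le_iff[OF t(2)])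
        qed
        then show ?case using z by (auto intro: le_less_trans)
      qed
    qed
  }
qed

lemma measurable_eln [measurable]: "eln \<in> borel_measurable borel"
  unfolding eln_def[abs_def] by measurable

lemma Theta_limsup_le_iff:
  fixes \<A> :: "(real \<Rightarrow> complex^'d^'d^'n) set"
  assumes \<nu>: "matrix_norm \<nu>" and bd: "uniformly_locally_bounded \<nu> \<A>" and \<A>: "\<A> \<subseteq> Linf_loc \<nu>"
    and LV: "L \<in> Vplus \<Lambda>"
  shows "Limsup ((zdot L) going_to at_top within Nvec)
              (\<lambda>n. SUP A\<in>\<A>. esssup (lebesgue_on {zdot L n - Lmax L<..<zdot L n})
                 (\<lambda>t. eln (ennreal (\<nu> (Theta L \<Lambda> A n t))) / ereal t)) \<le> ereal \<gamma>
     \<longleftrightarrow> Theta_exp_type \<nu> L \<Lambda> \<A> \<gamma>"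
proof
  have L: "L \<in> pos_vec" using LV by (simp add: Vplus_def)
  have Lm: "0 < Lmax L" by (rule Lmax_pos[OF L])
  have J: "{zdot L n - Lmax L<..<zdot L n} \<in> sets lebesgue" for n by simp
  define \<Psi> where "\<Psi> A n = esssup (lebesgue_on {zdot L n - Lmax L<..<zdot L n})
                 (\<lambda>t. eln (ennreal (\<nu> (Theta L \<Lambda> A n t))) / ereal t)" for A n
  {
    assume "Limsup ((zdot L) going_to at_top within Nvec)
              (\<lambda>n. SUP A\<in>\<A>. esssup (lebesgue_on {zdot L n - Lmax L<..<zdot L n})
                 (\<lambda>t. eln (ennreal (\<nu> (Theta L \<Lambda> A n t))) / ereal t)) \<le> ereal \<gamma>"
    then have le: "Limsup ((zdot L) going_to at_top within Nvec) (\<lambda>n. SUP A\<in>\<A>. \<Psi> A n) \<le> ereal \<gamma>"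
      by (simp add: \<Psi>_def)
    show "Theta_exp_type \<nu> L \<Lambda> \<A> \<gamma>"
      unfolding Theta_exp_type_def
    proof (intro allI impI)
      fix \<epsilon> :: real assume \<epsilon>: "0 < \<epsilon>"
      define g where "g = \<gamma> + \<epsilon>"
      have "ereal \<gamma> < ereal g" using \<epsilon> by (simp add: g_def)
      then have "\<forall>\<^sub>F n in (zdot L) going_to at_top within Nvec. (SUP A\<in>\<A>. \<Psi> A n) < ereal g"
        using le unfolding Limsup_le_iff by blast
      then obtain T0 where T0: "\<And>n. n \<in> Nvec \<Longrightarrow> T0 \<le> zdot L n \<Longrightarrow> (SUP A\<in>\<A>. \<Psi> A n) < ereal g"
        unfolding eventually_going_to_at_top_linorder by blast
      \<comment> \<open>Beyond this level the whole interval of \<open>n\<close> lies in positive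
        times, so dividing by \<open>t\<close> preserves inequalities. Below it,
        \<open>Lmax L \<le> T\<close> gives \<open>\<bar>t\<bar> \<le> T\<close>, also for negative
        \<open>t\<close>.\<close>
      define T where "T = max T0 (Lmax L)"
      obtain B where B: "0 \<le> B" "\<And>A n. A \<in> \<A> \<Longrightarrow> n \<in> sublevel L T \<Longrightarrow>
          AE t in lebesgue. t \<in> {- Lmax L..T} \<longrightarrow> norm (Theta L \<Lambda> A n t) \<le> B"
        using Theta_bounded_on_sublevel[OF \<nu> bd LV] by blast
      obtain C where C: "0 < C" "\<And>M. \<nu> M \<le> C * norm M"
        using matrix_norm_equivalent[OF \<nu>] by blast
      define K where "K = max 1 (C * B * exp (\<bar>g\<bar> * T))"
      have "AE t in lebesgue. t \<in> {zdot L n - Lmax L<..<zdot L n} \<longrightarrow> \<nu> (Theta L \<Lambda> A n t) \<le> K * exp (g * t)"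
        if A: "A \<in> \<A>" and n: "n \<in> Nvec" for A n
      proof (cases "zdot L n \<le> T")
        case True
        then have "n \<in> sublevel L T" using n by (simp add: sublevel_def)
        from B(2)[OF A this] show ?thesis
        proof eventually_elim
          case (elim t)
          show ?case
          proof
            assume t: "t \<in> {zdot L n - Lmax L<..<zdot L n}"
            then have t': "t \<in> {- Lmax L..T}" using True zdot_nonneg[OF L n] by auto
            then have "C * norm (Theta L \<Lambda> A n t) \<le> C * (B * exp (g * 0))"
              using elim C by (intro mult_left_mono) auto
            also have "\<dots> \<le> C * (B * (exp (\<bar>g\<bar> * T) * exp (g * t)))"
              using C B t' by (intro mult_left_mono exp_le_exp_shift) (auto simp: T_def)
            also have "\<dots> = C * B * exp (\<bar>g\<bar> * T) * exp (g * t)" by simp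
            also have "\<dots> \<le> K * exp (g * t)" by (intro mult_right_mono) (auto simp: K_def)
            finally show "\<nu> (Theta L \<Lambda> A n t) \<le> K * exp (g * t)"
              using C(2)[of "Theta L \<Lambda> A n t"] by linarith
          qed
        qed
      next
        case False
        have "\<Psi> A n \<le> ereal g"
        proof -
          have "\<Psi> A n \<le> (SUP A\<in>\<A>. \<Psi> A n)" by (rule SUP_upper[OF A])
          also have "\<dots> \<le> ereal g" using T0[OF n] False by (auto simp: T_def intro: less_imp_le)
          finally show ?thesis .
        qed
        moreover have "AE t in lebesgue. t \<in> {zdot L n - Lmax L<..<zdot L n} \<longrightarrow>
            eln (ennreal (\<nu> (Theta L \<Lambda> A n t))) / ereal t \<le> \<Psi> A n"
          unfolding \<Psi>_def AE_lebesgue_on_iff[OF J, symmetric] by (rule esssup_AE)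
        ultimately show ?thesis
        proof (elim eventually_mono, intro impI)
          fix t
          assume t: "t \<in> {zdot L n - Lmax L<..<zdot L n}"
            and h: "t \<in> {zdot L n - Lmax L<..<zdot L n} \<longrightarrow>
              eln (ennreal (\<nu> (Theta L \<Lambda> A n t))) / ereal t \<le> \<Psi> A n" and "\<Psi> A n \<le> ereal g"
          then have "eln (ennreal (\<nu> (Theta L \<Lambda> A n t))) / ereal t \<le> ereal g" by (meson order.trans)
          moreover have "0 < t" using t False by (auto simp: T_def)
          ultimately have "\<nu> (Theta L \<Lambda> A n t) \<le> exp (g * t)"
            by (simp add: eln_divide_le_iff ennreal_le_iff)
          also have "\<dots> \<le> K * exp (g * t)"
            using mult_right_mono[of 1 K "exp (g * t)"] by (simp add: K_def)
          finally show "\<nu> (Theta L \<Lambda> A n t) \<le> K * exp (g * t)" .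
        qed
      qed
      moreover have "0 < K" by (simp add: K_def)
      ultimately show "\<exists>K>0. \<forall>A\<in>\<A>. \<forall>n\<in>Nvec. AE t in lebesgue.
        t \<in> {zdot L n - Lmax L<..<zdot L n} \<longrightarrow> \<nu> (Theta L \<Lambda> A n t) \<le> K * exp ((\<gamma> + \<epsilon>) * t)"
        unfolding g_def by blast
    qed
  }
  {
    assume ex: "Theta_exp_type \<nu> L \<Lambda> \<A> \<gamma>"
    have "Limsup ((zdot L) going_to at_top within Nvec) (\<lambda>n. SUP A\<in>\<A>. \<Psi> A n) \<le> ereal \<gamma>"
      unfolding Limsup_le_iff
    proof (intro allI impI)
      fix y assume "ereal \<gamma> < y"
      then obtain z where z: "\<gamma> < z" "ereal z < y" using ereal_dense2[of "ereal \<gamma>" y] by auto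
      define g where "g = (\<gamma> + z) / 2"
      have g: "\<gamma> < g" "g < z" using z by (auto simp: g_def)
      obtain K where K: "0 < K" "\<And>A n. A \<in> \<A> \<Longrightarrow> n \<in> Nvec \<Longrightarrow> AE t in lebesgue.
          t \<in> {zdot L n - Lmax L<..<zdot L n} \<longrightarrow> \<nu> (Theta L \<Lambda> A n t) \<le> K * exp (g * t)"
        by (rule Theta_exp_typeE[OF ex g(1)]) simp_all
      obtain T where T: "\<And>t. T \<le> t \<Longrightarrow> K * exp (g * t) \<le> exp (z * t)"
        using eventually_const_exp_le[OF g(2) K(1)] by blast
      show "\<forall>\<^sub>F n in (zdot L) going_to at_top within Nvec. (SUP A\<in>\<A>. \<Psi> A n) < y"
        unfolding eventually_going_to_at_top_linorder
      proof (intro exI ballI impI)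
        \<comment> \<open>The shift by \<open>Lmax L\<close> keeps the entire interval of
          \<open>n\<close> beyond both 0 and \<open>T\<close>.\<close>
        fix n :: "int^'n" assume n: "n \<in> Nvec" "max T 0 + Lmax L \<le> zdot L n"
        have "(SUP A\<in>\<A>. \<Psi> A n) \<le> ereal z"
        proof (rule SUP_least)
          fix A assume A: "A \<in> \<A>"
          have Am: "A \<in> borel_measurable lebesgue" using A \<A> by (auto simp: Linf_loc_def)
          have [measurable]: "\<nu> \<in> borel_measurable borel"
            by (intro borel_measurable_continuous_onI continuous_matrix_norm \<nu>)
          have [measurable]: "Theta L \<Lambda> A n \<in> borel_measurable lebesgue"
            by (rule measurable_Theta[OF Am LV])
          have [measurable]: "(\<lambda>t::real. t) \<in> borel_measurable lebesgue"
            by (rule measurable_completion) simp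
          have "(\<lambda>t. eln (ennreal (\<nu> (Theta L \<Lambda> A n t))) / ereal t) \<in> borel_measurable lebesgue"
            by measurable
          \<comment> \<open>Measurability matters: on a function that is not measurable,
            \<open>esssup\<close> takes its top value by default.\<close>
          then have m: "(\<lambda>t. eln (ennreal (\<nu> (Theta L \<Lambda> A n t))) / ereal t)
              \<in> borel_measurable (lebesgue_on {zdot L n - Lmax L<..<zdot L n})"
            by (rule measurable_restrict_space1)
          show "\<Psi> A n \<le> ereal z"
            unfolding \<Psi>_def
          proof (rule esssup_I[OF m])
            show "AE t in lebesgue_on {zdot L n - Lmax L<..<zdot L n}.
                eln (ennreal (\<nu> (Theta L \<Lambda> A n t))) / ereal t \<le> ereal z"
              unfolding AE_lebesgue_on_iff[OF J] using K(2)[OF A n(1)]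
            proof (elim eventually_mono, intro impI)
              fix t
              assume t: "t \<in> {zdot L n - Lmax L<..<zdot L n}"
                and h: "t \<in> {zdot L n - Lmax L<..<zdot L n} \<longrightarrow> \<nu> (Theta L \<Lambda> A n t) \<le> K * exp (g * t)"
              have t': "0 < t" "T \<le> t" using t n(2) by auto
              have "\<nu> (Theta L \<Lambda> A n t) \<le> exp (z * t)" using h t T[OF t'(2)] by auto
              then show "eln (ennreal (\<nu> (Theta L \<Lambda> A n t))) / ereal t \<le> ereal z"
                unfolding eln_divide_le_iff[OF t'(1)] by (rule ennreal_leI)
            qed
          qed
        qed
        then show "(SUP A\<in>\<A>. \<Psi> A n) < y" using z by (auto intro: le_less_trans)
      qed
    qed
    then show "Limsup ((zdot L) going_to at_top within Nvec)
              (\<lambda>n. SUP A\<in>\<A>. esssup (lebesgue_on {zdot L n - Lmax L<..<zdot L n})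
                 (\<lambda>t. eln (ennreal (\<nu> (Theta L \<Lambda> A n t))) / ereal t)) \<le> ereal \<gamma>"
      by (simp add: \<Psi>_def)
  }
qed

theorem theorem3p21:
  fixes \<nu> :: "complex^'d^'d \<Rightarrow> real"
    and \<Lambda> :: "real^'n"
    and \<A> :: "(real \<Rightarrow> complex^'d^'d^'n) set"
  assumes "matrix_norm \<nu>"
    and "\<Lambda> \<in> pos_vec"
    and "\<A> \<subseteq> Linf_loc \<nu>"
    and "uniformly_locally_bounded \<nu> \<A>"
  shows "(\<forall>L\<in>Vplus \<Lambda>. \<forall>\<gamma>. Theta_exp_type \<nu> L \<Lambda> \<A> \<gamma> \<longrightarrow> (\<forall>p\<ge>1. exp_type L \<A> p \<gamma>)) \<and>
         (\<forall>L\<in>Wplus \<Lambda>. \<forall>\<gamma>. (\<exists>p\<ge>1. exp_type L \<A> p \<gamma>) \<longrightarrow> Theta_exp_type \<nu> L \<Lambda> \<A> \<gamma>) \<and>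
         (\<forall>L\<in>Wplus \<Lambda>. \<forall>p\<ge>1. max_lyapunov L \<A> p =
            Limsup ((zdot L) going_to at_top within Nvec)
              (\<lambda>n. SUP A\<in>\<A>. esssup (lebesgue_on {zdot L n - Lmax L<..<zdot L n})
                 (\<lambda>t. eln (ennreal (\<nu> (Theta L \<Lambda> A n t))) / ereal t)))"
proof (intro conjI ballI allI impI)
  fix L \<gamma> and p :: ennreal
  assume "L \<in> Vplus \<Lambda>" "Theta_exp_type \<nu> L \<Lambda> \<A> \<gamma>" "1 \<le> p"
  then show "exp_type L \<A> p \<gamma>"
    using exp_type_of_Theta_exp_type[OF assms(1,3) _ assms(2)] by blast
next
  fix L \<gamma>
  assume "L \<in> Wplus \<Lambda>" "\<exists>p\<ge>1. exp_type L \<A> p \<gamma>"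
  then show "Theta_exp_type \<nu> L \<Lambda> \<A> \<gamma>"
    using Theta_exp_type_of_exp_type[OF assms(1,4,3) _ assms(2)] by blast
next
  fix L and p :: ennreal
  assume LW: "L \<in> Wplus \<Lambda>" and p: "1 \<le> p"
  have LV: "L \<in> Vplus \<Lambda>" using LW Wplus_subset_Vplus by blast
  have "exp_type L \<A> p \<gamma> \<longleftrightarrow> Theta_exp_type \<nu> L \<Lambda> \<A> \<gamma>" for \<gamma>
    using exp_type_of_Theta_exp_type[OF assms(1,3) LV assms(2) p]
      Theta_exp_type_of_exp_type[OF assms(1,4,3) LW assms(2) p] by blast
  then have iff: "max_lyapunov L \<A> p \<le> ereal \<gamma> \<longleftrightarrow>
      Limsup ((zdot L) going_to at_top within Nvec)
              (\<lambda>n. SUP A\<in>\<A>. esssup (lebesgue_on {zdot L n - Lmax L<..<zdot L n})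
                 (\<lambda>t. eln (ennreal (\<nu> (Theta L \<Lambda> A n t))) / ereal t)) \<le> ereal \<gamma>" for \<gamma>
    unfolding max_lyapunov_le_iff[OF assms(1,4,3) LV assms(2) p]
      Theta_limsup_le_iff[OF assms(1,4,3) LV] .
  \<comment> \<open>Extended reals with the same real upper bounds are equal, infinite values
    included, so neither limit superior has to be known finite.\<close>
  show "max_lyapunov L \<A> p =
      Limsup ((zdot L) going_to at_top within Nvec)
              (\<lambda>n. SUP A\<in>\<A>. esssup (lebesgue_on {zdot L n - Lmax L<..<zdot L n})
                 (\<lambda>t. eln (ennreal (\<nu> (Theta L \<Lambda> A n t))) / ereal t))"
    by (rule antisym; rule ereal_le_real) (erule iffD2[OF iff], erule iffD1[OF iff])
qed

end
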